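(* Let $T$ be a string of length $n$ over a totally ordered alphabet $\Sigma$. There is an algorithm that computes a longest subsequence of $T$ having at least one exponent in $\bigcup_{x \in \mathbb{N}} (3x,4x) \cap \mathbb{Q}^+$. The algorithm runs in $O(n^7)$ time and uses $O(n^4)$ words of space.
   Context: $\mathbb{N}=\{1,2,\dots\}$ and $\mathbb{Q}^+$ denotes the set of rational numbers greater than or equal to $1$; $(3x,4x)$ denotes an open interval of rational numbers. A subsequence of a string $T$ is a string $T[i_1]T[i_2]\cdots T[i_\ell]$ with $i_1<\dots<i_\ell$. For a string $S$, write $S = U^x U'$ where $x\in\mathbb{N}$, $U$ is nonempty and $U'$ is empty or a proper prefix of $U$; then $|U|$ is called a period of $S$ and $x + |U'|/|U| \in \mathbb{Q}^+$ (which equals $|S|/|U|$) is called the exponent of $S$ with respect to the period $|U|$. A string may have several periods and hence several exponents; "having an exponent in a set $E$" means that at least one of its exponents lies in $E$. *)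

theory Defs
  imports Complex_Main "HOL-Library.Sublist" "HOL-Library.Landau_Symbols"
begin

section \<open>Exponents of strings\<close>

text \<open>As \<open>U\<close> is nonempty, \<^const>\<open>strict_prefix\<close> covers both options for \<open>U'\<close>: empty, or a
  proper prefix of \<open>U\<close>.\<close>

definition has_exponent :: "'a list \<Rightarrow> rat \<Rightarrow> bool" where
  "has_exponent S e \<longleftrightarrow>
     (\<exists>U x U'. x \<ge> 1 \<and> U \<noteq> [] \<and> strict_prefix U' U \<and> S = concat (replicate x U) @ U' \<and>
        e = of_nat x + of_nat (length U') / of_nat (length U))"

definition exponent_set :: "rat set" where
  "exponent_set = (\<Union>x\<in>{1::nat..}. {3 * of_nat x <..< 4 * of_nat x}) \<inter> {1..}"

definition longest_subseq_with_exponent_in :: "rat set \<Rightarrow> 'a list \<Rightarrow> 'a list \<Rightarrow> bool" where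
  "longest_subseq_with_exponent_in E T S \<longleftrightarrow>
     subseq S T \<and> (\<exists>e\<in>E. has_exponent S e) \<and>
     (\<forall>S'. subseq S' T \<and> (\<exists>e\<in>E. has_exponent S' e) \<longrightarrow> length S' \<le> length S)"


section \<open>Word RAM programs\<close>

text \<open>
  A word RAM with unit-cost operations on \<open>w\<close>-bit words. A program has finitely many registers and a
  random access memory, both initially zero. Characters of the alphabet are not words: the input
  \<open>T\<close> is read-only and is accessed only through its length and through comparisons of two of its
  characters. The result is a string, written character by character, from left to right, to a
  write-only output.
\<close>

datatype exp =
    Const nat
  | Len
  | Reg nat
  | Mem exp
  | Add exp exp
  | Sub exp exp
  | Mul exp exp

datatype cond =
    Less exp exp
  | Eq exp exp
  | CharLe exp exp  \<comment> \<open>compares the characters at two input positions\<close>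
  | Not cond
  | And cond cond

datatype com =
    Skip
  | Assign nat exp
  | Store exp exp   \<comment> \<open>address, value\<close>
  | Emit exp        \<comment> \<open>appends the character at the given input position to the output\<close>
  | Seq com com
  | If cond com com
  | While cond com

type_synonym 'a state = "(nat \<Rightarrow> nat) \<times> (nat \<Rightarrow> nat) \<times> 'a list"  \<comment> \<open>registers, memory, output\<close>

definition init_state :: "'a state" where
  "init_state = (\<lambda>_. 0, \<lambda>_. 0, [])"

fun regs_exp :: "exp \<Rightarrow> nat set" where
  "regs_exp (Const k) = {}"
| "regs_exp Len = {}"
| "regs_exp (Reg x) = {x}"
| "regs_exp (Mem e) = regs_exp e"
| "regs_exp (Add e1 e2) = regs_exp e1 \<union> regs_exp e2"
| "regs_exp (Sub e1 e2) = regs_exp e1 \<union> regs_exp e2"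
| "regs_exp (Mul e1 e2) = regs_exp e1 \<union> regs_exp e2"

fun regs_cond :: "cond \<Rightarrow> nat set" where
  "regs_cond (Less e1 e2) = regs_exp e1 \<union> regs_exp e2"
| "regs_cond (Eq e1 e2) = regs_exp e1 \<union> regs_exp e2"
| "regs_cond (CharLe e1 e2) = regs_exp e1 \<union> regs_exp e2"
| "regs_cond (Not b) = regs_cond b"
| "regs_cond (And b1 b2) = regs_cond b1 \<union> regs_cond b2"

fun regs :: "com \<Rightarrow> nat set" where
  "regs Skip = {}"
| "regs (Assign x e) = insert x (regs_exp e)"
| "regs (Store a e) = regs_exp a \<union> regs_exp e"
| "regs (Emit e) = regs_exp e"
| "regs (Seq c1 c2) = regs c1 \<union> regs c2"
| "regs (If b c1 c2) = regs_cond b \<union> regs c1 \<union> regs c2"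
| "regs (While b c) = regs_cond b \<union> regs c"

fun val :: "'a list \<Rightarrow> 'a state \<Rightarrow> exp \<Rightarrow> nat" where
  "val T \<sigma> (Const k) = k"
| "val T \<sigma> Len = length T"
| "val T (R, M, out) (Reg x) = R x"
| "val T (R, M, out) (Mem e) = M (val T (R, M, out) e)"
| "val T \<sigma> (Add e1 e2) = val T \<sigma> e1 + val T \<sigma> e2"
| "val T \<sigma> (Sub e1 e2) = val T \<sigma> e1 - val T \<sigma> e2"
| "val T \<sigma> (Mul e1 e2) = val T \<sigma> e1 * val T \<sigma> e2"

text \<open>The order \<open>r\<close> on the alphabet is given as a reflexive relation.\<close>

fun holds :: "('a \<times> 'a) set \<Rightarrow> 'a list \<Rightarrow> 'a state \<Rightarrow> cond \<Rightarrow> bool" where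
  "holds r T \<sigma> (Less e1 e2) \<longleftrightarrow> val T \<sigma> e1 < val T \<sigma> e2"
| "holds r T \<sigma> (Eq e1 e2) \<longleftrightarrow> val T \<sigma> e1 = val T \<sigma> e2"
| "holds r T \<sigma> (CharLe e1 e2) \<longleftrightarrow> (T ! val T \<sigma> e1, T ! val T \<sigma> e2) \<in> r"
| "holds r T \<sigma> (Not b) \<longleftrightarrow> \<not> holds r T \<sigma> b"
| "holds r T \<sigma> (And b1 b2) \<longleftrightarrow> holds r T \<sigma> b1 \<and> holds r T \<sigma> b2"

text \<open>
  Evaluation is safe if every value that occurs, intermediate ones included, fits into a \<open>w\<close>-bit
  word, every memory address is less than the memory size \<open>m\<close>, and every input position is valid.
  Unsafe evaluation blocks the machine.
\<close>

fun safe :: "nat \<Rightarrow> nat \<Rightarrow> 'a list \<Rightarrow> 'a state \<Rightarrow> exp \<Rightarrow> bool" where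
  "safe w m T \<sigma> (Const k) \<longleftrightarrow> k < 2 ^ w"
| "safe w m T \<sigma> Len \<longleftrightarrow> length T < 2 ^ w"
| "safe w m T \<sigma> (Reg x) \<longleftrightarrow> True"
| "safe w m T \<sigma> (Mem e) \<longleftrightarrow> safe w m T \<sigma> e \<and> val T \<sigma> e < m"
| "safe w m T \<sigma> (Add e1 e2) \<longleftrightarrow>
     safe w m T \<sigma> e1 \<and> safe w m T \<sigma> e2 \<and> val T \<sigma> (Add e1 e2) < 2 ^ w"
| "safe w m T \<sigma> (Sub e1 e2) \<longleftrightarrow> safe w m T \<sigma> e1 \<and> safe w m T \<sigma> e2"
| "safe w m T \<sigma> (Mul e1 e2) \<longleftrightarrow>
     safe w m T \<sigma> e1 \<and> safe w m T \<sigma> e2 \<and> val T \<sigma> (Mul e1 e2) < 2 ^ w"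

fun safe_cond :: "nat \<Rightarrow> nat \<Rightarrow> 'a list \<Rightarrow> 'a state \<Rightarrow> cond \<Rightarrow> bool" where
  "safe_cond w m T \<sigma> (Less e1 e2) \<longleftrightarrow> safe w m T \<sigma> e1 \<and> safe w m T \<sigma> e2"
| "safe_cond w m T \<sigma> (Eq e1 e2) \<longleftrightarrow> safe w m T \<sigma> e1 \<and> safe w m T \<sigma> e2"
| "safe_cond w m T \<sigma> (CharLe e1 e2) \<longleftrightarrow>
     safe w m T \<sigma> e1 \<and> safe w m T \<sigma> e2 \<and> val T \<sigma> e1 < length T \<and> val T \<sigma> e2 < length T"
| "safe_cond w m T \<sigma> (Not b) \<longleftrightarrow> safe_cond w m T \<sigma> b"
| "safe_cond w m T \<sigma> (And b1 b2) \<longleftrightarrow> safe_cond w m T \<sigma> b1 \<and> safe_cond w m T \<sigma> b2"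

fun cost_exp :: "exp \<Rightarrow> nat" where
  "cost_exp (Const k) = 1"
| "cost_exp Len = 1"
| "cost_exp (Reg x) = 1"
| "cost_exp (Mem e) = 1 + cost_exp e"
| "cost_exp (Add e1 e2) = 1 + cost_exp e1 + cost_exp e2"
| "cost_exp (Sub e1 e2) = 1 + cost_exp e1 + cost_exp e2"
| "cost_exp (Mul e1 e2) = 1 + cost_exp e1 + cost_exp e2"

fun cost_cond :: "cond \<Rightarrow> nat" where
  "cost_cond (Less e1 e2) = 1 + cost_exp e1 + cost_exp e2"
| "cost_cond (Eq e1 e2) = 1 + cost_exp e1 + cost_exp e2"
| "cost_cond (CharLe e1 e2) = 1 + cost_exp e1 + cost_exp e2"
| "cost_cond (Not b) = 1 + cost_cond b"
| "cost_cond (And b1 b2) = 1 + cost_cond b1 + cost_cond b2"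

text \<open>
  \<open>run r w m T c \<sigma> t \<sigma>'\<close>: on input \<open>T\<close>, with word length \<open>w\<close> and \<open>m\<close> memory cells, \<open>c\<close> started in
  \<open>\<sigma>\<close> terminates in \<open>\<sigma>'\<close> after \<open>t\<close> steps.
\<close>

inductive run :: "('a \<times> 'a) set \<Rightarrow> nat \<Rightarrow> nat \<Rightarrow> 'a list \<Rightarrow> com \<Rightarrow> 'a state \<Rightarrow> nat \<Rightarrow> 'a state \<Rightarrow> bool"
  for r :: "('a \<times> 'a) set" and w m :: nat and T :: "'a list"
where
  run_Skip: "run r w m T Skip \<sigma> 1 \<sigma>"
| run_Assign: "safe w m T (R, M, out) e \<Longrightarrow>
    run r w m T (Assign x e) (R, M, out) (1 + cost_exp e) (R(x := val T (R, M, out) e), M, out)"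
| run_Store: "safe w m T (R, M, out) a \<Longrightarrow> val T (R, M, out) a < m \<Longrightarrow> safe w m T (R, M, out) e \<Longrightarrow>
    run r w m T (Store a e) (R, M, out) (1 + cost_exp a + cost_exp e)
      (R, M(val T (R, M, out) a := val T (R, M, out) e), out)"
| run_Emit: "safe w m T (R, M, out) e \<Longrightarrow> val T (R, M, out) e < length T \<Longrightarrow>
    run r w m T (Emit e) (R, M, out) (1 + cost_exp e) (R, M, out @ [T ! val T (R, M, out) e])"
| run_Seq: "run r w m T c1 \<sigma>1 t1 \<sigma>2 \<Longrightarrow> run r w m T c2 \<sigma>2 t2 \<sigma>3 \<Longrightarrow>
    run r w m T (Seq c1 c2) \<sigma>1 (t1 + t2) \<sigma>3"
| run_IfTrue: "safe_cond w m T \<sigma> b \<Longrightarrow> holds r T \<sigma> b \<Longrightarrow> run r w m T c1 \<sigma> t \<sigma>' \<Longrightarrow>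
    run r w m T (If b c1 c2) \<sigma> (1 + cost_cond b + t) \<sigma>'"
| run_IfFalse: "safe_cond w m T \<sigma> b \<Longrightarrow> \<not> holds r T \<sigma> b \<Longrightarrow> run r w m T c2 \<sigma> t \<sigma>' \<Longrightarrow>
    run r w m T (If b c1 c2) \<sigma> (1 + cost_cond b + t) \<sigma>'"
| run_WhileFalse: "safe_cond w m T \<sigma> b \<Longrightarrow> \<not> holds r T \<sigma> b \<Longrightarrow>
    run r w m T (While b c) \<sigma> (1 + cost_cond b) \<sigma>"
| run_WhileTrue: "safe_cond w m T \<sigma>1 b \<Longrightarrow> holds r T \<sigma>1 b \<Longrightarrow> run r w m T c \<sigma>1 t1 \<sigma>2 \<Longrightarrow>
    run r w m T (While b c) \<sigma>2 t2 \<sigma>3 \<Longrightarrow>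
    run r w m T (While b c) \<sigma>1 (1 + cost_cond b + t1 + t2) \<sigma>3"

lemma run_deterministic:
  "run r w m T c \<sigma> t \<sigma>' \<Longrightarrow> run r w m T c \<sigma> t' \<sigma>'' \<Longrightarrow> t = t' \<and> \<sigma>' = \<sigma>''"
proof (induction arbitrary: t' \<sigma>'' rule: run.induct)
  case (run_WhileTrue \<sigma>1 b c t1 \<sigma>2 t2 \<sigma>3)
  from run_WhileTrue.prems show ?case
    by (cases rule: run.cases) (use run_WhileTrue in blast)+
qed (erule run.cases; blast)+

text \<open>
  Words consist of \<open>k * \<lceil>log 2 (n + 2)\<rceil>\<close> bits for a constant \<open>k\<close> that depends on the program only.
  The space is the number of registers and memory cells; as usual, the read-only input and the
  write-only output are not counted. The function computed may assign to an input \<open>T\<close> any string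
  \<open>S\<close> with \<open>Q T S\<close>. The alphabet \<open>\<Sigma>\<close> and its order are quantified after the program, which is
  therefore the same for all of them.
\<close>

definition computable_in ::
  "('a list \<Rightarrow> 'a list \<Rightarrow> bool) \<Rightarrow> (nat \<Rightarrow> nat) \<Rightarrow> (nat \<Rightarrow> nat) \<Rightarrow> bool" where
  "computable_in Q time space \<longleftrightarrow>
     (\<exists>P k. \<forall>(\<Sigma> :: 'a set) r T. linear_order_on \<Sigma> r \<and> set T \<subseteq> \<Sigma> \<longrightarrow>
        (\<exists>m t R M S.
           run r (k * nat \<lceil>log 2 (real (length T + 2))\<rceil>) m T P init_state t (R, M, S) \<and>
           t \<le> time (length T) \<and> card (regs P) + m \<le> space (length T) \<and> Q T S))"

end

theory Submission
  imports Defs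
begin

text \<open>
  A string of exponent \<open>e \<in> (3x, 4x)\<close> with respect to the period \<open>p\<close> also has the period \<open>x * p\<close>, with
  exponent \<open>e / x \<in> (3, 4)\<close>. So the strings in question are those of the form \<open>VWVWVWV\<close> with \<open>V\<close> and
  \<open>W\<close> nonempty. If the second, third and fourth copy of \<open>V\<close> start at the positions \<open>a\<close>, \<open>b\<close> and \<open>c\<close> of
  the text, then \<open>VW\<close> is a common subsequence of the pieces ending before \<open>a\<close>, \<open>b\<close> and \<open>c\<close>, and \<open>V\<close> is
  also a subsequence of the last piece. For each of the \<open>n ^ 3\<close> choices of \<open>a\<close>, \<open>b\<close>, \<open>c\<close>, a variant of
  the dynamic program for the longest common subsequence of four strings finds the best \<open>V\<close> and \<open>W\<close> with
  a table of \<open>(n + 1) ^ 4\<close> cells. The table is reused; only the starts of the best solution are remembered,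
  and the table is recomputed for them before the solution is traced back, once per copy.
\<close>

section \<open>Reduction to exponents between 3 and 4\<close>

text \<open>One table serves both parts \<open>V\<close> and \<open>W\<close>, because the fourth
  index \<open>l\<close> records which of them is being matched. Below the end of the text a match
  uses all four pieces and extends \<open>V\<close>; skipping \<open>l\<close> to the end switches
  to matches in three pieces, which extend \<open>W\<close>. The weights 4 and 3 make the value of a
  pair the length of \<open>VWVWVWV\<close>. Both parts must be nonempty, and this is enforced in
  two ways. For \<open>W\<close>, the value 0 is reserved for "no solution", and a four-way match is
  only allowed in front of a positive value. For \<open>V\<close>, the first letter of each copy is
  pinned: a solution has equal letters at its four starts \<open>i\<close>, \<open>a\<close>,
  \<open>b\<close>, \<open>c\<close>, and the table is read one position behind them. The exponent 7
  rests on the fact that a table depends on the ends \<open>a\<close>, \<open>b\<close>,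
  \<open>c\<close> of the first three pieces, but not on the start \<open>i\<close> of the first
  copy. So \<open>n ^ 3\<close> tables of \<open>(n + 1) ^ 4\<close> cells are filled, and all
  values of \<open>i\<close> are read off the same table.\<close>

lemma concat_replicate_add:
  "concat (replicate (x + y) U) = concat (replicate x U) @ concat (replicate y U)"
  by (simp add: replicate_add)

lemma concat_replicate_mult:
  "concat (replicate (x * y) U) = concat (replicate x (concat (replicate y U)))"
  by (induction x) (auto simp: replicate_add)

text \<open>Regroup \<open>U ^ x U'\<close> into blocks \<open>U ^ y\<close>: three of them fit,
  \<open>V\<close> is what remains, and \<open>W\<close> completes \<open>V\<close> to a fourth
  block. Strictness of the bounds makes both parts nonempty: \<open>V = []\<close> would force
  \<open>e = 3 * y\<close>, and \<open>e < 4 * y\<close> leaves at least the tail \<open>U''\<close>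
  to \<open>W\<close>. Conversely, \<open>V\<close> is a proper nonempty part of
  \<open>V @ W\<close>, which puts the exponent into the interval for \<open>x = 1\<close>.\<close>

lemma exponent_in_set_iff:
  "(\<exists>e\<in>exponent_set. has_exponent S e) \<longleftrightarrow>
     (\<exists>V W. V \<noteq> [] \<and> W \<noteq> [] \<and> S = (V @ W) @ (V @ W) @ (V @ W) @ V)"
proof
  assume "\<exists>e\<in>exponent_set. has_exponent S e"
  then obtain e y U x U' where y: "y \<ge> 1" "3 * rat_of_nat y < e" "e < 4 * rat_of_nat y"
    and "strict_prefix U' U" and S: "S = concat (replicate x U) @ U'"
    and e: "e = of_nat x + of_nat (length U') / of_nat (length U)"
    unfolding exponent_set_def has_exponent_def by auto
  then obtain U'' where U: "U = U' @ U''" "U'' \<noteq> []"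
    by (auto elim!: strict_prefixE')
  then have frac: "0 \<le> rat_of_nat (length U') / of_nat (length U)"
    "rat_of_nat (length U') / of_nat (length U) < 1"
    by (auto simp: divide_less_eq)
  \<comment> \<open>The fractional part lies in [0, 1), so \<open>e\<close> is between
    \<open>x\<close> and \<open>x + 1\<close>. Over the integers \<open>3 * y < x + 1\<close> then
    says that three blocks fit into \<open>U ^ x\<close>, and \<open>z\<close> counts the copies of
    \<open>U\<close> left over.\<close>
  have "rat_of_nat (3 * y) < rat_of_nat (x + 1)" "rat_of_nat x < rat_of_nat (4 * y)"
    using y(2,3) e frac by (simp_all only: of_nat_mult of_nat_add of_nat_numeral of_nat_1)
  then have "3 * y < x + 1" "x < 4 * y"
    by (simp_all only: of_nat_less_iff)
  then obtain z where z: "x = 3 * y + z" "z < y"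
    by (intro that[of "x - 3 * y"]) simp_all
  define V where "V = concat (replicate z U) @ U'"
  define W where "W = U'' @ concat (replicate (y - z - 1) U)"
  have "V \<noteq> []"
  proof
    assume "V = []"
    then have "z = 0" "U' = []"
      using U by (auto simp: V_def)
    then show False using y e z by simp
  qed
  moreover have "W \<noteq> []" using U by (simp add: W_def)
  moreover have "V @ W = concat (replicate (z + (1 + (y - z - 1))) U)"
    unfolding concat_replicate_add V_def W_def using U by simp
  then have VW: "V @ W = concat (replicate y U)" using z by simp
  have "S = concat (replicate 3 (V @ W)) @ V"
    unfolding VW unfolding S z(1) concat_replicate_add concat_replicate_mult V_def by simp
  then have "S = (V @ W) @ (V @ W) @ (V @ W) @ V"
    by (simp add: numeral_eq_Suc)
  ultimately show "\<exists>V W. V \<noteq> [] \<and> W \<noteq> [] \<and> S = (V @ W) @ (V @ W) @ (V @ W) @ V"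
    by blast
next
  assume "\<exists>V W. V \<noteq> [] \<and> W \<noteq> [] \<and> S = (V @ W) @ (V @ W) @ (V @ W) @ V"
  then obtain V W where VW: "V \<noteq> []" "W \<noteq> []" "S = (V @ W) @ (V @ W) @ (V @ W) @ V"
    by blast
  define e :: rat where "e = of_nat 3 + of_nat (length V) / of_nat (length (V @ W))"
  have "0 < rat_of_nat (length V) / of_nat (length (V @ W))"
    "rat_of_nat (length V) / of_nat (length (V @ W)) < 1"
    using VW by (auto simp: field_simps add_pos_pos add_pos_nonneg)
  then have "e \<in> exponent_set"
    unfolding exponent_set_def e_def by (auto intro!: bexI[of _ 1])
  moreover have "has_exponent S e"
    unfolding has_exponent_def e_def using VW
    by (intro exI[of _ "V @ W"] exI[of _ 3] exI[of _ V])
      (auto simp: numeral_eq_Suc strict_prefix_def)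
  ultimately show "\<exists>e\<in>exponent_set. has_exponent S e" by blast
qed

section \<open>The dynamic program\<close>

definition segment :: "'a list \<Rightarrow> nat \<Rightarrow> nat \<Rightarrow> 'a list" where
  "segment T i e = take (e - i) (drop i T)"

lemma segment_empty: "e \<le> i \<Longrightarrow> segment T i e = []"
  by (simp add: segment_def)

lemma segment_Cons: "i < e \<Longrightarrow> e \<le> length T \<Longrightarrow> segment T i e = T ! i # segment T (Suc i) e"
proof -
  assume "i < e" "e \<le> length T"
  then have "drop i T = T ! i # drop (Suc i) T" "e - i = Suc (e - Suc i)"
    by (simp_all add: Cons_nth_drop_Suc)
  then show ?thesis unfolding segment_def by (simp only: take_Suc_Cons)
qed

lemma subseq_segment_Suc:
  "e \<le> length T \<Longrightarrow> subseq xs (segment T (Suc i) e) \<Longrightarrow> subseq xs (segment T i e)"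
  by (cases "i < e") (simp_all add: segment_Cons segment_empty list_emb_Cons)

lemma segment_append:
  "i \<le> p \<Longrightarrow> p \<le> e \<Longrightarrow> segment T i e = segment T i p @ segment T p e"
proof -
  assume "i \<le> p" "p \<le> e"
  then have "e - i = (p - i) + (e - p)" "drop p T = drop (p - i) (drop i T)" by simp_all
  then show ?thesis unfolding segment_def by (simp only: take_add)
qed

text \<open>The tool for locating copies: with \<open>x\<close> the first letter of a copy, an
  embedding of a concatenation is traded for a position \<open>p\<close> of \<open>x\<close> and
  independent embeddings on its two sides. \<open>candidate_upper\<close> extracts the starts with
  it, \<open>result_sound\<close> glues the pieces together.\<close>

lemma subseq_segment_Cons_iff:
  assumes "e \<le> length T"
  shows "subseq (xs @ x # ys) (segment T i e) \<longleftrightarrow>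
    (\<exists>p. i \<le> p \<and> p < e \<and> T ! p = x \<and> subseq xs (segment T i p) \<and> subseq ys (segment T (Suc p) e))"
proof
  assume "subseq (xs @ x # ys) (segment T i e)"
  then obtain us vs where s: "segment T i e = us @ x # vs" "subseq xs us" "subseq ys vs"
  proof -
    from \<open>subseq (xs @ x # ys) (segment T i e)\<close> obtain us vs where
      1: "segment T i e = us @ vs" "subseq xs us" "subseq (x # ys) vs"
      by (auto dest: list_emb_appendD)
    then obtain us' v vs' where 2: "vs = us' @ v # vs'" "x = v" "subseq ys vs'"
      by (blast dest: list_emb_ConsD)
    \<comment> \<open>\<open>us'\<close> holds the letters skipped before the match of
      \<open>x\<close>; they join the left part.\<close>
    have "subseq (xs @ []) (us @ us')" using 1(2) by (intro list_emb_append_mono) auto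
    then have "subseq xs (us @ us')" by simp
    with 1 2 show ?thesis using that[of "us @ us'" vs'] by simp
  qed
  let ?p = "i + length us"
  have len: "length (segment T i e) \<le> e - i" by (simp add: segment_def)
  then have p: "?p < e" using s by simp
  have "segment T i e = segment T i ?p @ segment T ?p e" by (rule segment_append) (use p in auto)
  also have "\<dots> = segment T i ?p @ T ! ?p # segment T (Suc ?p) e"
    using p assms by (simp add: segment_Cons)
  finally have "us @ x # vs = segment T i ?p @ T ! ?p # segment T (Suc ?p) e" using s by simp
  moreover have "length (segment T i ?p) = length us"
    using p assms by (simp add: segment_def)
  ultimately have "us = segment T i ?p" "x = T ! ?p" "vs = segment T (Suc ?p) e"
    by (simp_all add: append_eq_append_conv)
  then show "\<exists>p. i \<le> p \<and> p < e \<and> T ! p = x \<and> subseq xs (segment T i p) \<and>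
      subseq ys (segment T (Suc p) e)"
    using s p by (intro exI[of _ ?p]) auto
next
  assume "\<exists>p. i \<le> p \<and> p < e \<and> T ! p = x \<and> subseq xs (segment T i p) \<and>
      subseq ys (segment T (Suc p) e)"
  then obtain p where p: "i \<le> p" "p < e" "T ! p = x" "subseq xs (segment T i p)"
      "subseq ys (segment T (Suc p) e)" by blast
  then have "segment T i e = segment T i p @ x # segment T (Suc p) e"
    using assms by (simp add: segment_append[of i p e] segment_Cons[of p e])
  then show "subseq (xs @ x # ys) (segment T i e)"
    using p by (simp add: list_emb_append_mono)
qed

section \<open>The value of an optimal pair\<close>

text \<open>\<open>i\<close>, \<open>j\<close>, \<open>k\<close>, \<open>l\<close> are the
  coordinates of a table cell, while the ends \<open>a\<close>, \<open>b\<close>, \<open>c\<close>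
  are fixed for a whole table. The shared first letter of the copies is stripped before this is
  applied, so \<open>V\<close> may be empty here.\<close>

definition embeds :: "'a list \<Rightarrow> nat \<Rightarrow> nat \<Rightarrow> nat \<Rightarrow> nat \<Rightarrow> nat \<Rightarrow> nat \<Rightarrow> nat \<Rightarrow> 'a list \<Rightarrow> 'a list \<Rightarrow>
    bool" where
  "embeds T a b c i j k l V W \<longleftrightarrow>
     subseq (V @ W) (segment T i a) \<and> subseq (V @ W) (segment T j b) \<and>
     subseq (V @ W) (segment T k c) \<and> subseq V (segment T l (length T))"

text \<open>The maximum of \<open>4 * length V + 3 * length W\<close> over all \<open>V\<close> and all nonempty \<open>W\<close> with
  \<open>embeds T a b c i j k l V W\<close>; the value 0 means that there are none. Once \<open>l\<close> has reached the end
  of \<open>T\<close>, only letters of \<open>W\<close> are matched, in three places instead of four.\<close>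

function opt :: "'a list \<Rightarrow> nat \<Rightarrow> nat \<Rightarrow> nat \<Rightarrow> nat \<Rightarrow> nat \<Rightarrow> nat \<Rightarrow> nat \<Rightarrow> nat" where
  "opt T a b c i j k l =
    (if i < a \<and> j < b \<and> k < c then
       if l < length T then
         max (max (max (max (opt T a b c (Suc i) j k l) (opt T a b c i (Suc j) k l))
           (opt T a b c i j (Suc k) l)) (opt T a b c i j k (Suc l)))
           (if T ! i = T ! j \<and> T ! i = T ! k \<and> T ! i = T ! l \<and>
               0 < opt T a b c (Suc i) (Suc j) (Suc k) (Suc l)
            then 4 + opt T a b c (Suc i) (Suc j) (Suc k) (Suc l) else 0)
       else
         max (max (max (opt T a b c (Suc i) j k l) (opt T a b c i (Suc j) k l))
           (opt T a b c i j (Suc k) l))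
           (if T ! i = T ! j \<and> T ! i = T ! k then 3 + opt T a b c (Suc i) (Suc j) (Suc k) l else 0)
     else 0)"
  by pat_completeness auto
termination
  by (relation "measure (\<lambda>(T, a, b, c, i, j, k, l). (a - i) + (b - j) + (c - k) + (length T - l))")
    auto

declare opt.simps [simp del]

lemma opt_out_of_range: "\<not> (i < a \<and> j < b \<and> k < c) \<Longrightarrow> opt T a b c i j k l = 0"
  by (subst opt.simps) (simp only: if_False)

lemma opt_mono:
  assumes "i < a" "j < b" "k < c"
  shows "opt T a b c (Suc i) j k l \<le> opt T a b c i j k l"
    and "opt T a b c i (Suc j) k l \<le> opt T a b c i j k l"
    and "opt T a b c i j (Suc k) l \<le> opt T a b c i j k l"
    and "l < length T \<Longrightarrow> opt T a b c i j k (Suc l) \<le> opt T a b c i j k l"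
  using assms by (simp_all add: opt.simps[of T a b c i j k l] max.coboundedI1)

lemma opt_ge_match:
  assumes "i < a" "j < b" "k < c" "T ! i = T ! j" "T ! i = T ! k"
  shows "l < length T \<Longrightarrow> T ! i = T ! l \<Longrightarrow> 0 < opt T a b c (Suc i) (Suc j) (Suc k) (Suc l) \<Longrightarrow>
      4 + opt T a b c (Suc i) (Suc j) (Suc k) (Suc l) \<le> opt T a b c i j k l"
    and "\<not> l < length T \<Longrightarrow> 3 + opt T a b c (Suc i) (Suc j) (Suc k) l \<le> opt T a b c i j k l"
  using assms by (simp_all add: opt.simps[of T a b c i j k l])

text \<open>Every match gains at most 4 and advances \<open>i\<close>. The bound keeps table values
  within a word.\<close>

lemma opt_bound: "opt T a b c i j k l \<le> 4 * (a - i)"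
proof (induction T a b c i j k l rule: opt.induct)
  case (1 T a b c i j k l)
  show ?case
  proof (cases "i < a \<and> j < b \<and> k < c")
    case True
    then have step: "4 * (a - i) = 4 + 4 * (a - Suc i)" by arith
    show ?thesis
    proof (cases "l < length T")
      case l: True
      with 1 True step show ?thesis by (subst opt.simps) (simp add: le_SucI trans_le_add2)
    next
      case l: False
      with 1 True step show ?thesis
        by (subst opt.simps) (auto simp: trans_le_add2 intro: le_SucI)
    qed
  qed (simp add: opt_out_of_range)
qed

text \<open>Let \<open>x\<close> be the first letter of \<open>V @ W\<close>. If the letter at
  \<open>i\<close>, \<open>j\<close> or \<open>k\<close> differs from \<open>x\<close>, the
  embedding survives skipping it. If all three equal \<open>x\<close>, matching them at once loses
  nothing, since an embedding may use the first available occurrence. Only \<open>l\<close> needs a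
  further distinction, as it follows \<open>V\<close> alone.\<close>

lemma opt_upper:
  assumes "W \<noteq> []" "embeds T a b c i j k l V W" "a \<le> length T" "b \<le> length T" "c \<le> length T"
  shows "4 * length V + 3 * length W \<le> opt T a b c i j k l"
  using assms
proof (induction T a b c i j k l arbitrary: V W rule: opt.induct)
  case (1 T a b c i j k l)
  have range: "i < a \<and> j < b \<and> k < c"
  proof (rule ccontr)
    assume "\<not> (i < a \<and> j < b \<and> k < c)"
    then have "segment T i a = [] \<or> segment T j b = [] \<or> segment T k c = []"
      by (auto simp: segment_empty)
    then show False using "1.prems"(1,2) by (auto simp: embeds_def)
  qed
  note segs = segment_Cons[of i a T] segment_Cons[of j b T] segment_Cons[of k c T]
    segment_Cons[of l "length T" T]
  obtain x Z where xZ: "V @ W = x # Z" using "1.prems" by (cases "V @ W") auto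
  consider "T ! i \<noteq> x" | "T ! j \<noteq> x" | "T ! k \<noteq> x" | "T ! i = x" "T ! j = x" "T ! k = x"
    by blast
  then show ?case
  proof cases
    assume "T ! i \<noteq> x"
    then have "embeds T a b c (Suc i) j k l V W"
      using "1.prems" range xZ by (auto simp: embeds_def segs)
    then have "4 * length V + 3 * length W \<le> opt T a b c (Suc i) j k l"
      using "1.prems" range by (cases "l < length T") (intro "1.IH"(1) "1.IH"(7); assumption)+
    also have "\<dots> \<le> opt T a b c i j k l" using range by (intro opt_mono) auto
    finally show ?thesis .
  next
    assume "T ! j \<noteq> x"
    then have "embeds T a b c i (Suc j) k l V W"
      using "1.prems" range xZ by (auto simp: embeds_def segs)
    then have "4 * length V + 3 * length W \<le> opt T a b c i (Suc j) k l"
      using "1.prems" range by (cases "l < length T") (intro "1.IH"(2) "1.IH"(8); assumption)+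
    also have "\<dots> \<le> opt T a b c i j k l" using range by (intro opt_mono) auto
    finally show ?thesis .
  next
    assume "T ! k \<noteq> x"
    then have "embeds T a b c i j (Suc k) l V W"
      using "1.prems" range xZ by (auto simp: embeds_def segs)
    then have "4 * length V + 3 * length W \<le> opt T a b c i j (Suc k) l"
      using "1.prems" range by (cases "l < length T") (intro "1.IH"(3) "1.IH"(9); assumption)+
    also have "\<dots> \<le> opt T a b c i j k l" using range by (intro opt_mono) auto
    finally show ?thesis .
  next
    assume eq: "T ! i = x" "T ! j = x" "T ! k = x"
    show ?thesis
    proof (cases "l < length T")
      case False
      then have V: "V = []" using "1.prems" by (auto simp: embeds_def segment_empty)
      \<comment> \<open>\<open>Z\<close> is the rest of \<open>W\<close>. The induction hypothesis
        asks for a nonempty rest, so the last letter of \<open>W\<close> is treated apart.\<close>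
      have "3 * length Z \<le> opt T a b c (Suc i) (Suc j) (Suc k) l"
      proof (cases "Z = []")
        case nonempty: False
        have "embeds T a b c (Suc i) (Suc j) (Suc k) l [] Z"
          using "1.prems" range xZ V eq by (auto simp: embeds_def segs)
        moreover have "T ! i = T ! j \<and> T ! i = T ! k" using eq by simp
        ultimately have "4 * length ([] :: 'a list) + 3 * length Z \<le>
            opt T a b c (Suc i) (Suc j) (Suc k) l"
          using "1.prems" range False nonempty by (intro "1.IH"(10))
        then show ?thesis by simp
      qed simp
      moreover have "3 + opt T a b c (Suc i) (Suc j) (Suc k) l \<le> opt T a b c i j k l"
        using range False eq by (intro opt_ge_match) auto
      ultimately show ?thesis using V xZ by simp
    next
      case True
      show ?thesis
      \<comment> \<open>Either \<open>V\<close> is used up or its next letter is not at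
        \<open>l\<close>; in both cases \<open>l\<close> moves on without a match. For
        \<open>V = []\<close> this repeats until \<open>l\<close> reaches the end and the phase of
        \<open>W\<close> begins.\<close>
      proof (cases "V = [] \<or> (\<exists>V'. V = x # V' \<and> T ! l \<noteq> x)")
        case skip: True
        then have "embeds T a b c i j k (Suc l) V W"
          using "1.prems" range True by (auto simp: embeds_def segs)
        then have "4 * length V + 3 * length W \<le> opt T a b c i j k (Suc l)"
          using "1.prems" range True by (intro "1.IH"(4))
        also have "\<dots> \<le> opt T a b c i j k l" using range True by (intro opt_mono) auto
        finally show ?thesis .
      next
        case False
        then obtain V' where V': "V = x # V'" "T ! l = x"
          using xZ by (cases V) auto
        then have "embeds T a b c (Suc i) (Suc j) (Suc k) (Suc l) V' W"
          using "1.prems" range True eq by (auto simp: embeds_def segs)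
        then have "4 * length V' + 3 * length W \<le> opt T a b c (Suc i) (Suc j) (Suc k) (Suc l)"
          using "1.prems" range True by (intro "1.IH"(5))
        \<comment> \<open>\<open>W\<close> nonempty makes the value behind the match positive, as
          the guard of the four-way match demands.\<close>
        moreover have "0 < length W" using "1.prems" by simp
        moreover from calculation have "0 < opt T a b c (Suc i) (Suc j) (Suc k) (Suc l)"
          by linarith
        then have "4 + opt T a b c (Suc i) (Suc j) (Suc k) (Suc l) \<le> opt T a b c i j k l"
          using V' range True eq by (intro opt_ge_match) auto
        ultimately show ?thesis using V' by simp
      qed
    qed
  qed
qed

lemma opt_pos_range: "opt T a b c i j k l \<noteq> 0 \<Longrightarrow> i < a \<and> j < b \<and> k < c"
  using opt_out_of_range by metis

section \<open>Recovering an optimal pair from the values\<close>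

text \<open>A skip is preferred whenever it preserves the value, so a match is taken only if it is
  forced, and no letters have to be compared. The order of the tests is that of
  \<open>trace_step\<close>: each turn of the program's loop is one unfolding of this function.
  Value 0 stops both at an infeasible cell and after the last letter of \<open>W\<close>.\<close>

function opt_pair :: "'a list \<Rightarrow> nat \<Rightarrow> nat \<Rightarrow> nat \<Rightarrow> nat \<Rightarrow> nat \<Rightarrow> nat \<Rightarrow> nat \<Rightarrow> 'a list \<times> 'a list" where
  "opt_pair T a b c i j k l =
    (if opt T a b c i j k l = 0 then ([], [])
     else if opt T a b c (Suc i) j k l = opt T a b c i j k l then opt_pair T a b c (Suc i) j k l
     else if opt T a b c i (Suc j) k l = opt T a b c i j k l then opt_pair T a b c i (Suc j) k l
     else if opt T a b c i j (Suc k) l = opt T a b c i j k l then opt_pair T a b c i j (Suc k) l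
     else if l < length T then
       if opt T a b c i j k (Suc l) = opt T a b c i j k l then opt_pair T a b c i j k (Suc l)
       else apfst ((#) (T ! i)) (opt_pair T a b c (Suc i) (Suc j) (Suc k) (Suc l))
     else apsnd ((#) (T ! i)) (opt_pair T a b c (Suc i) (Suc j) (Suc k) l))"
  by pat_completeness auto
termination
proof (relation "measure (\<lambda>(T, a, b, c, i, j, k, l). (a - i) + (b - j) + (c - k) + (length T - l))",
    goal_cases)
  \<comment> \<open>A nonzero value puts \<open>i\<close>, \<open>j\<close>, \<open>k\<close> below
    \<open>a\<close>, \<open>b\<close>, \<open>c\<close>, so advancing any of them lowers the
    measure.\<close>
  case (2 T a b c i j k l)
  from opt_pos_range[OF 2(1)] show ?case by (simp; arith)
next
  case (3 T a b c i j k l)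
  from opt_pos_range[OF 3(1)] show ?case by (simp; arith)
next
  case (4 T a b c i j k l)
  from opt_pos_range[OF 4(1)] show ?case by (simp; arith)
next
  case (5 T a b c i j k l)
  from opt_pos_range[OF 5(1)] 5(5) show ?case by (simp; arith)
next
  case (6 T a b c i j k l)
  from opt_pos_range[OF 6(1)] show ?case by (simp; arith)
next
  case (7 T a b c i j k l)
  from opt_pos_range[OF 7(1)] show ?case by (simp; arith)
qed simp

declare opt_pair.simps [simp del]

text \<open>The value is a maximum over skips and one match. If no skip attains it, the match does,
  and a positive value means that the match has passed its guard. Equality of letters is thus
  recovered from the stored numbers.\<close>

lemma opt_match:
  assumes "0 < opt T a b c i j k l"
    and "opt T a b c (Suc i) j k l \<noteq> opt T a b c i j k l"
    and "opt T a b c i (Suc j) k l \<noteq> opt T a b c i j k l"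
    and "opt T a b c i j (Suc k) l \<noteq> opt T a b c i j k l"
    and "l < length T \<Longrightarrow> opt T a b c i j k (Suc l) \<noteq> opt T a b c i j k l"
  shows "T ! i = T ! j" "T ! i = T ! k"
    and "l < length T \<Longrightarrow> T ! i = T ! l \<and> 0 < opt T a b c (Suc i) (Suc j) (Suc k) (Suc l) \<and>
        opt T a b c i j k l = 4 + opt T a b c (Suc i) (Suc j) (Suc k) (Suc l)"
    and "\<not> l < length T \<Longrightarrow> opt T a b c i j k l = 3 + opt T a b c (Suc i) (Suc j) (Suc k) l"
proof -
  have range: "i < a \<and> j < b \<and> k < c" using assms(1) opt_pos_range[of T a b c i j k l] by auto
  \<comment> \<open>\<open>max2\<close> shows that the nested maximum of the skips differs from the
    value; \<open>max\<close> then leaves the last argument, the match.\<close>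
  have max: "v = e" if "v = max m e" "v \<noteq> m" for v m e :: nat
    using that unfolding max_def by presburger
  have max2: "max m e \<noteq> v" if "m \<noteq> v" "e \<noteq> v" for v m e :: nat using that by (auto simp: max_def)
  have "T ! i = T ! j \<and> T ! i = T ! k \<and>
    (if l < length T then T ! i = T ! l \<and> 0 < opt T a b c (Suc i) (Suc j) (Suc k) (Suc l) \<and>
        opt T a b c i j k l = 4 + opt T a b c (Suc i) (Suc j) (Suc k) (Suc l)
     else opt T a b c i j k l = 3 + opt T a b c (Suc i) (Suc j) (Suc k) l)"
  proof (cases "l < length T")
    case True
    have "opt T a b c i j k l = (if T ! i = T ! j \<and> T ! i = T ! k \<and> T ! i = T ! l \<and>
               0 < opt T a b c (Suc i) (Suc j) (Suc k) (Suc l)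
            then 4 + opt T a b c (Suc i) (Suc j) (Suc k) (Suc l) else 0)"
      by (rule max, subst opt.simps, simp only: range True if_True simp_thms)
        (intro max2[THEN not_sym] max2 assms(2-5) True)
    then show ?thesis using assms(1) True by (auto split: if_splits)
  next
    case False
    have "opt T a b c i j k l = (if T ! i = T ! j \<and> T ! i = T ! k
            then 3 + opt T a b c (Suc i) (Suc j) (Suc k) l else 0)"
      by (rule max, subst opt.simps, simp only: range False if_True if_False simp_thms)
        (intro max2[THEN not_sym] max2 assms(2-4))
    then show ?thesis using assms(1) False by (auto split: if_splits)
  qed
  then show "T ! i = T ! j" "T ! i = T ! k"
    and "l < length T \<Longrightarrow> T ! i = T ! l \<and> 0 < opt T a b c (Suc i) (Suc j) (Suc k) (Suc l) \<and>
        opt T a b c i j k l = 4 + opt T a b c (Suc i) (Suc j) (Suc k) (Suc l)"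
    and "\<not> l < length T \<Longrightarrow> opt T a b c i j k l = 3 + opt T a b c (Suc i) (Suc j) (Suc k) l"
    by (auto split: if_splits)
qed

text \<open>Counterpart of \<open>opt_upper\<close>: together they make the traced pair optimal.
  After a skip, an embedding into the shorter segment is one into the longer; a match puts the same
  letter in front in all segments involved.\<close>

lemma opt_pair_sound:
  assumes "0 < opt T a b c i j k l" "a \<le> length T" "b \<le> length T" "c \<le> length T"
  shows "snd (opt_pair T a b c i j k l) \<noteq> [] \<and>
    embeds T a b c i j k l (fst (opt_pair T a b c i j k l)) (snd (opt_pair T a b c i j k l)) \<and>
    opt T a b c i j k l = 4 * length (fst (opt_pair T a b c i j k l)) + 3 * length (snd (opt_pair
        T a b c i j k l))"
  using assms
proof (induction T a b c i j k l rule: opt_pair.induct)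
  case (1 T a b c i j k l)
  have range: "i < a" "j < b" "k < c" using "1.prems"(1) opt_pos_range[of T a b c i j k l] by auto
  note segs = segment_Cons[of i a T] segment_Cons[of j b T] segment_Cons[of k c T]
    segment_Cons[of l "length T" T]
  note pos = "1.prems"(1)[THEN less_imp_neq, THEN not_sym]
  show ?case
  proof (cases "opt T a b c (Suc i) j k l = opt T a b c i j k l")
    case True
    have "opt_pair T a b c i j k l = opt_pair T a b c (Suc i) j k l"
      by (subst opt_pair.simps) (simp only: if_not_P[OF pos] if_P[OF True])
    with "1.IH"(1)[OF pos True] True "1.prems" show ?thesis
      by (simp add: embeds_def subseq_segment_Suc[of _ T _ i])
  next
    case i: False
    show ?thesis
    proof (cases "opt T a b c i (Suc j) k l = opt T a b c i j k l")
      case True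
      have "opt_pair T a b c i j k l = opt_pair T a b c i (Suc j) k l"
        by (subst opt_pair.simps) (simp only: if_not_P[OF pos] if_not_P[OF i] if_P[OF True])
      with "1.IH"(2)[OF pos i True] True "1.prems" show ?thesis
        by (simp add: embeds_def subseq_segment_Suc[of _ T _ j])
    next
      case j: False
      show ?thesis
      proof (cases "opt T a b c i j (Suc k) l = opt T a b c i j k l")
        case True
        have "opt_pair T a b c i j k l = opt_pair T a b c i j (Suc k) l"
          by (subst opt_pair.simps) (simp only: if_not_P[OF pos] if_not_P[OF i] if_not_P[OF j]
              if_P[OF True])
        with "1.IH"(3)[OF pos i j True] True "1.prems" show ?thesis
          by (simp add: embeds_def subseq_segment_Suc[of _ T _ k])
      next
        case k: False
        show ?thesis
        proof (cases "l < length T")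
          case l: True
          show ?thesis
          proof (cases "opt T a b c i j k (Suc l) = opt T a b c i j k l")
            case True
            have "opt_pair T a b c i j k l = opt_pair T a b c i j k (Suc l)"
              by (subst opt_pair.simps) (simp only: if_not_P[OF pos] if_not_P[OF i]
                if_not_P[OF j] if_not_P[OF k] if_P[OF l] if_P[OF True])
            with "1.IH"(4)[OF pos i j k l True] True "1.prems" show ?thesis
              by (simp add: embeds_def subseq_segment_Suc[of _ T _ l])
          next
            case False
            note m = opt_match[OF "1.prems"(1) i j k False]
            have "opt_pair T a b c i j k l = apfst ((#) (T ! i)) (opt_pair T a b c (Suc i) (Suc j)
                (Suc k) (Suc l))"
              by (subst opt_pair.simps) (simp only: if_not_P[OF pos] if_not_P[OF i]
                if_not_P[OF j] if_not_P[OF k] if_P[OF l] if_not_P[OF False])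
            then show ?thesis using "1.IH"(5)[OF pos i j k l False] "1.prems" range m l
              by (auto simp: embeds_def segs)
          qed
        next
          case l: False
          have no: "l < length T \<Longrightarrow> opt T a b c i j k (Suc l) \<noteq> opt T a b c i j k l"
            using l by simp
          note m = opt_match[OF "1.prems"(1) i j k no]
          have t: "opt_pair T a b c i j k l = apsnd ((#) (T ! i)) (opt_pair T a b c (Suc i) (Suc
              j) (Suc k) l)"
            by (subst opt_pair.simps) (simp only: if_not_P[OF pos] if_not_P[OF i]
                if_not_P[OF j] if_not_P[OF k] if_not_P[OF l])
          show ?thesis
          proof (cases "0 < opt T a b c (Suc i) (Suc j) (Suc k) l")
            case True
            \<comment> \<open>The letter is prepended to the \<open>W\<close> part. It comes first
              in \<open>V @ W\<close> because the \<open>V\<close> part is empty once the fourth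
              segment is exhausted.\<close>
            have "fst (opt_pair T a b c (Suc i) (Suc j) (Suc k) l) = []"
              using "1.IH"(6)[OF pos i j k l True] "1.prems" l
              by (auto simp: embeds_def segment_empty)
            with t "1.IH"(6)[OF pos i j k l True] "1.prems" range m l
            show ?thesis by (auto simp: embeds_def segs)
          next
            \<comment> \<open>Value 0 behind a three-way match: the matched letter is the last one
              of \<open>W\<close>.\<close>
            case False
            then have "opt_pair T a b c (Suc i) (Suc j) (Suc k) l = ([], [])"
              by (subst opt_pair.simps) simp
            with t range m l False "1.prems" show ?thesis by (auto simp: embeds_def segs)
          qed
        qed
      qed
    qed
  qed
qed

section \<open>From optimal pairs to longest subsequences\<close>

text \<open>Length of the best solution whose copies start at \<open>i\<close>, \<open>a\<close>,
  \<open>b\<close>, \<open>c\<close>. The 4 counts the pinned first letter once per copy, and this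
  letter makes \<open>V\<close> nonempty. A positive cell also forces the four starts to
  increase.\<close>

definition candidate :: "'a list \<Rightarrow> nat \<Rightarrow> nat \<Rightarrow> nat \<Rightarrow> nat \<Rightarrow> nat" where
  "candidate T a b c i =
    (if T ! i = T ! a \<and> T ! i = T ! b \<and> T ! i = T ! c \<and>
        0 < opt T a b c (Suc i) (Suc a) (Suc b) (Suc c)
     then 4 + opt T a b c (Suc i) (Suc a) (Suc b) (Suc c) else 0)"

definition result :: "'a list \<Rightarrow> nat \<Rightarrow> nat \<Rightarrow> nat \<Rightarrow> nat \<Rightarrow> 'a list" where
  "result T a b c i =
    (let (V, W) = opt_pair T a b c (Suc i) (Suc a) (Suc b) (Suc c); U = T ! i # V @ W
     in U @ U @ U @ T ! i # V)"

lemma segment_full: "segment T 0 (length T) = T"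
  by (simp add: segment_def)

text \<open>Splitting the embedding at the first letter of each copy yields the four starts. Between
  consecutive starts lies an embedding of \<open>V' @ W\<close>, where \<open>V'\<close> is
  \<open>V\<close> without that letter, so \<open>opt_upper\<close> applies.\<close>

lemma candidate_upper:
  assumes "subseq ((V @ W) @ (V @ W) @ (V @ W) @ V) T" "V \<noteq> []" "W \<noteq> []"
  shows "\<exists>a b c i. a < length T \<and> b < length T \<and> c < length T \<and> i < length T \<and>
    4 * length V + 3 * length W \<le> candidate T a b c i"
proof -
  let ?n = "length T"
  obtain x V' where V: "V = x # V'" using assms(2) by (cases V) auto
  let ?Z = "V' @ W"
  have "subseq ([] @ x # ?Z @ x # ?Z @ x # ?Z @ x # V') (segment T 0 ?n)"
    using assms V by (simp add: segment_full)
  then obtain i where i: "i < ?n" "T ! i = x"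
    "subseq (?Z @ x # ?Z @ x # ?Z @ x # V') (segment T (Suc i) ?n)"
    by (subst (asm) subseq_segment_Cons_iff) auto
  then obtain a where a: "a < ?n" "T ! a = x" "subseq ?Z (segment T (Suc i) a)"
    "subseq (?Z @ x # ?Z @ x # V') (segment T (Suc a) ?n)"
    by (subst (asm) subseq_segment_Cons_iff) auto
  then obtain b where b: "b < ?n" "T ! b = x" "subseq ?Z (segment T (Suc a) b)"
    "subseq (?Z @ x # V') (segment T (Suc b) ?n)"
    by (subst (asm) subseq_segment_Cons_iff) auto
  then obtain c where c: "c < ?n" "T ! c = x" "subseq ?Z (segment T (Suc b) c)"
    "subseq V' (segment T (Suc c) ?n)"
    by (subst (asm) subseq_segment_Cons_iff) auto
  have "4 * length V' + 3 * length W \<le> opt T a b c (Suc i) (Suc a) (Suc b) (Suc c)"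
    using i a b c assms(3) by (intro opt_upper) (auto simp: embeds_def)
  moreover have "0 < length W" using assms(3) by simp
  moreover from calculation have "0 < opt T a b c (Suc i) (Suc a) (Suc b) (Suc c)" by linarith
  ultimately have "4 * length V + 3 * length W \<le> candidate T a b c i"
    using i a b c V by (simp add: candidate_def)
  then show ?thesis using i a b c by blast
qed

lemma result_sound:
  assumes "a < length T" "b < length T" "c < length T" "i < length T" "0 < candidate T a b c i"
  shows "subseq (result T a b c i) T" "\<exists>e\<in>exponent_set. has_exponent (result T a b c i) e"
    and "length (result T a b c i) = candidate T a b c i"
proof -
  let ?n = "length T"
  obtain V W where VW: "opt_pair T a b c (Suc i) (Suc a) (Suc b) (Suc c) = (V, W)"
    by fastforce
  let ?x = "T ! i"
  have candidate: "?x = T ! a" "?x = T ! b" "?x = T ! c"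
    "0 < opt T a b c (Suc i) (Suc a) (Suc b) (Suc c)"
    "candidate T a b c i = 4 + opt T a b c (Suc i) (Suc a) (Suc b) (Suc c)"
    using assms(5) by (auto simp: candidate_def split: if_splits)
  have order: "Suc i < a" "Suc a < b" "Suc b < c"
    using opt_pos_range[of T a b c "Suc i" "Suc a" "Suc b" "Suc c"] candidate(4) by auto
  have W: "W \<noteq> []" and emb: "embeds T a b c (Suc i) (Suc a) (Suc b) (Suc c) V W"
    and len: "opt T a b c (Suc i) (Suc a) (Suc b) (Suc c) = 4 * length V + 3 * length W"
    using opt_pair_sound[OF candidate(4)] assms VW by auto
  let ?Z = "V @ W"
  have res: "result T a b c i = ((?x # V) @ W) @ ((?x # V) @ W) @ ((?x # V) @ W) @ (?x # V)"
    by (simp add: result_def VW)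
  \<comment> \<open>The embedding is assembled from right to left: each step adds the start of one
    copy, together with the remainder of the copy before it.\<close>
  have "subseq (?Z @ ?x # V) (segment T (Suc b) ?n)"
    using emb order assms candidate
    by (subst subseq_segment_Cons_iff) (auto simp: embeds_def intro!: exI[of _ c])
  then have "subseq (?Z @ ?x # ?Z @ ?x # V) (segment T (Suc a) ?n)"
    using emb order assms candidate
    by (subst subseq_segment_Cons_iff) (auto simp: embeds_def intro!: exI[of _ b])
  then have "subseq (?Z @ ?x # ?Z @ ?x # ?Z @ ?x # V) (segment T (Suc i) ?n)"
    using emb order assms candidate
    by (subst subseq_segment_Cons_iff) (auto simp: embeds_def intro!: exI[of _ a])
  then have "subseq ([] @ ?x # ?Z @ ?x # ?Z @ ?x # ?Z @ ?x # V) (segment T 0 ?n)"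
    using assms by (subst subseq_segment_Cons_iff) (auto intro!: exI[of _ i])
  then show "subseq (result T a b c i) T"
    by (simp add: res segment_full)
  show "\<exists>e\<in>exponent_set. has_exponent (result T a b c i) e"
    unfolding exponent_in_set_iff using W res by blast
  show "length (result T a b c i) = candidate T a b c i"
    using len candidate by (simp add: res)
qed

lemma subseq_exponent_le_candidate:
  assumes "subseq S T" "\<exists>e\<in>exponent_set. has_exponent S e"
  shows "\<exists>a b c i. a < length T \<and> b < length T \<and> c < length T \<and> i < length T \<and>
    0 < length S \<and> length S \<le> candidate T a b c i"
proof -
  obtain V W where S: "V \<noteq> []" "W \<noteq> []" "S = (V @ W) @ (V @ W) @ (V @ W) @ V"
    using assms(2) unfolding exponent_in_set_iff by blast
  have "length S = 4 * length V + 3 * length W" "0 < length S" using S by simp_all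
  then show ?thesis using candidate_upper[OF _ S(1,2)] S(3) assms(1) by metis
qed

lemma longest_result:
  assumes "a < length T" "b < length T" "c < length T" "i < length T" "0 < candidate T a b c i"
    and "\<And>a' b' c' i'. a' < length T \<Longrightarrow> b' < length T \<Longrightarrow> c' < length T \<Longrightarrow> i' < length T \<Longrightarrow>
      candidate T a' b' c' i' \<le> candidate T a b c i"
  shows "longest_subseq_with_exponent_in exponent_set T (result T a b c i)"
  unfolding longest_subseq_with_exponent_in_def
proof (intro conjI allI impI result_sound(1,2) assms(1-5))
  fix S assume "subseq S T \<and> (\<exists>e\<in>exponent_set. has_exponent S e)"
  then obtain a' b' c' i' where "a' < length T" "b' < length T" "c' < length T" "i' < length T"
    "length S \<le> candidate T a' b' c' i'" using subseq_exponent_le_candidate[of S T] by blast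
  then show "length S \<le> length (result T a b c i)"
    using assms(6)[of a' b' c' i'] result_sound(3)[OF assms(1-5)] by simp
qed

lemma no_longest:
  assumes "\<And>a b c i. a < length T \<Longrightarrow> b < length T \<Longrightarrow> c < length T \<Longrightarrow> i < length T \<Longrightarrow>
      candidate T a b c i = 0"
  shows "\<not> longest_subseq_with_exponent_in exponent_set T S"
  unfolding longest_subseq_with_exponent_in_def
  using subseq_exponent_le_candidate[of S T] assms by fastforce

section \<open>A program logic with time bounds\<close>

type_synonym 'a assn = "(nat \<Rightarrow> nat) \<Rightarrow> (nat \<Rightarrow> nat) \<Rightarrow> 'a list \<Rightarrow> bool"

text \<open>Meaningful for loop-free code only: loops get the junk value 0 here,
    and the precondition \<open>False\<close>
  in \<open>wp\<close> below.\<close>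

primrec time_bound :: "com \<Rightarrow> nat" where
  "time_bound Skip = 1"
| "time_bound (Assign x e) = 1 + cost_exp e"
| "time_bound (Store a e) = 1 + cost_exp a + cost_exp e"
| "time_bound (Emit e) = 1 + cost_exp e"
| "time_bound (Seq c1 c2) = time_bound c1 + time_bound c2"
| "time_bound (If b c1 c2) = 1 + cost_cond b + time_bound c1 + time_bound c2"
| "time_bound (While b c) = 0"

text \<open>Counting down fits the recursion of \<open>opt\<close>, which refers to larger indices.
  The counter is decremented before the body, so the body sees the values from \<open>e - 1\<close>
  down to 0.\<close>

definition for_down :: "nat \<Rightarrow> exp \<Rightarrow> com \<Rightarrow> com" where
  "for_down x e c =
    Seq (Assign x e)
      (While (Less (Const 0) (Reg x)) (Seq (Assign x (Sub (Reg x) (Const 1))) c))"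

text \<open>\<open>m\<close> is exactly the size of the table. The exponent 8 leaves slack:
  addresses stay below \<open>(n + 1) ^ 4\<close>, and the other values are linear in
  \<open>n\<close>.\<close>

locale ram =
  fixes r :: "('a \<times> 'a) set" and w m :: nat and T :: "'a list" and \<Sigma> :: "'a set"
  assumes lin: "linear_order_on \<Sigma> r" and alphabet: "set T \<subseteq> \<Sigma>"
    and cells: "m = (length T + 1) ^ 4"
    and word: "(length T + 2) ^ 8 \<le> 2 ^ w"
begin

abbreviation n :: nat where "n \<equiv> length T"

primrec wp :: "com \<Rightarrow> 'a assn \<Rightarrow> 'a assn" where
  "wp Skip Q = Q"
| "wp (Assign x e) Q = (\<lambda>R M out. safe w m T (R, M, out) e \<and> Q (R(x := val T (R, M, out) e)) M out)"
| "wp (Store a e) Q = (\<lambda>R M out. safe w m T (R, M, out) a \<and> val T (R, M, out) a < m \<and>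
     safe w m T (R, M, out) e \<and> Q R (M(val T (R, M, out) a := val T (R, M, out) e)) out)"
| "wp (Emit e) Q = (\<lambda>R M out. safe w m T (R, M, out) e \<and> val T (R, M, out) e < length T \<and>
     Q R M (out @ [T ! val T (R, M, out) e]))"
| "wp (Seq c1 c2) Q = wp c1 (wp c2 Q)"
| "wp (If b c1 c2) Q = (\<lambda>R M out. safe_cond w m T (R, M, out) b \<and>
     (if holds r T (R, M, out) b then wp c1 Q R M out else wp c2 Q R M out))"
| "wp (While b c) Q = (\<lambda>R M out. False)"

definition hoare :: "'a assn \<Rightarrow> com \<Rightarrow> nat \<Rightarrow> 'a assn \<Rightarrow> bool" where
  "hoare P c t Q \<longleftrightarrow> (\<forall>R M out. P R M out \<longrightarrow>
     (\<exists>t' R' M' out'. t' \<le> t \<and> run r w m T c (R, M, out) t' (R', M', out') \<and> Q R' M' out'))"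

lemma wp_run:
  "wp c Q R M out \<Longrightarrow>
    \<exists>t' R' M' out'. t' \<le> time_bound c \<and> run r w m T c (R, M, out) t' (R', M', out') \<and> Q R' M' out'"
proof (induction c arbitrary: Q R M out)
  case (Seq c1 c2)
  from Seq.IH(1) Seq.prems obtain t1 R1 M1 out1 where 1: "t1 \<le> time_bound c1"
    "run r w m T c1 (R, M, out) t1 (R1, M1, out1)" "wp c2 Q R1 M1 out1" by fastforce
  from Seq.IH(2)[OF 1(3)] obtain t2 R2 M2 out2 where 2: "t2 \<le> time_bound c2"
    "run r w m T c2 (R1, M1, out1) t2 (R2, M2, out2)" "Q R2 M2 out2" by blast
  show ?case using run_Seq[OF 1(2) 2(2)] 1(1) 2(1,3) add_mono by fastforce
next
  case (If b c1 c2)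
  show ?case
  proof (cases "holds r T (R, M, out) b")
    case True
    with If.prems If.IH(1) obtain t R' M' out' where "t \<le> time_bound c1"
      "run r w m T c1 (R, M, out) t (R', M', out')" "Q R' M' out'" by fastforce
    moreover from this have "run r w m T (If b c1 c2) (R, M, out) (1 + cost_cond b + t) (R', M',
        out')"
      using If.prems True by (intro run_IfTrue) auto
    ultimately show ?thesis by (intro exI[of _ "1 + cost_cond b + t"]) auto
  next
    case False
    with If.prems If.IH(2) obtain t R' M' out' where "t \<le> time_bound c2"
      "run r w m T c2 (R, M, out) t (R', M', out')" "Q R' M' out'" by fastforce
    moreover from this have "run r w m T (If b c1 c2) (R, M, out) (1 + cost_cond b + t) (R', M',
        out')"
      using If.prems False by (intro run_IfFalse) auto
    ultimately show ?thesis by (intro exI[of _ "1 + cost_cond b + t"]) auto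
  qed
next
  case Skip
  then show ?case using run_Skip by fastforce
next
  case (Assign x e)
  then show ?case using run_Assign by fastforce
next
  case (Store a e)
  then show ?case using run_Store[of w m T R M out a e r]
    by (intro exI[of _ "1 + cost_exp a + cost_exp e"]) auto
next
  case (Emit e)
  then show ?case using run_Emit by fastforce
qed simp

lemma hoare_wp:
  "(\<And>R M out. P R M out \<Longrightarrow> wp c Q R M out) \<Longrightarrow> hoare P c (time_bound c) Q"
  using wp_run unfolding hoare_def by blast

lemma hoare_conseq:
  assumes "hoare P c t Q" "\<And>R M out. P' R M out \<Longrightarrow> P R M out"
    "\<And>R M out. Q R M out \<Longrightarrow> Q' R M out" "t \<le> t'"
  shows "hoare P' c t' Q'"
  unfolding hoare_def
proof (intro allI impI)
  fix R M out assume "P' R M out"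
  then obtain t1 R' M' out' where "t1 \<le> t" "run r w m T c (R, M, out) t1 (R', M', out')"
      "Q R' M' out'"
    using assms(1,2) unfolding hoare_def by blast
  then show "\<exists>t1 R' M' out'. t1 \<le> t' \<and> run r w m T c (R, M, out) t1 (R', M', out') \<and> Q' R' M' out'"
    using assms(3,4) le_trans by blast
qed

text \<open>Freezes the initial state, so that a postcondition can be related to registers that the
  code leaves alone.\<close>

lemma hoare_initial:
  assumes "\<And>R0 M0 out0. P R0 M0 out0 \<Longrightarrow>
    hoare (\<lambda>R M out. R = R0 \<and> M = M0 \<and> out = out0) c t Q"
  shows "hoare P c t Q"
  using assms unfolding hoare_def by blast

lemma hoare_seq:
  assumes "hoare P c1 t1 Q" "hoare Q c2 t2 S"
  shows "hoare P (Seq c1 c2) (t1 + t2) S"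
  unfolding hoare_def
proof (intro allI impI)
  fix R M out assume "P R M out"
  then obtain u1 R1 M1 out1 where 1: "u1 \<le> t1"
    "run r w m T c1 (R, M, out) u1 (R1, M1, out1)" "Q R1 M1 out1"
    using assms(1) unfolding hoare_def by blast
  then obtain u2 R2 M2 out2 where 2: "u2 \<le> t2"
    "run r w m T c2 (R1, M1, out1) u2 (R2, M2, out2)" "S R2 M2 out2"
    using assms(2) unfolding hoare_def by blast
  show "\<exists>t' R' M' out'. t' \<le> t1 + t2 \<and> run r w m T (Seq c1 c2) (R, M, out) t' (R', M', out') \<and>
      S R' M' out'"
    using run_Seq[OF 1(2) 2(2)] 1(1) 2(1,3) add_mono by blast
qed

lemma hoare_if:
  assumes "\<And>R M out. P R M out \<Longrightarrow> safe_cond w m T (R, M, out) b"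
    and "hoare (\<lambda>R M out. P R M out \<and> holds r T (R, M, out) b) c1 t1 Q"
    and "hoare (\<lambda>R M out. P R M out \<and> \<not> holds r T (R, M, out) b) c2 t2 Q"
  shows "hoare P (If b c1 c2) (1 + cost_cond b + t1 + t2) Q"
  unfolding hoare_def
proof (intro allI impI)
  fix R M out assume P: "P R M out"
  show "\<exists>t' R' M' out'. t' \<le> 1 + cost_cond b + t1 + t2 \<and>
      run r w m T (If b c1 c2) (R, M, out) t' (R', M', out') \<and> Q R' M' out'"
  proof (cases "holds r T (R, M, out) b")
    case True
    with P assms(2) obtain t R' M' out' where t: "t \<le> t1"
      "run r w m T c1 (R, M, out) t (R', M', out')" "Q R' M' out'" unfolding hoare_def by blast
    then show ?thesis using run_IfTrue[OF assms(1)[OF P] True t(2)]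
      by (intro exI[of _ "1 + cost_cond b + t"]) auto
  next
    case False
    with P assms(3) obtain t R' M' out' where t: "t \<le> t2"
      "run r w m T c2 (R, M, out) t (R', M', out')" "Q R' M' out'" unfolding hoare_def by blast
    then show ?thesis using run_IfFalse[OF assms(1)[OF P] False t(2)]
      by (intro exI[of _ "1 + cost_cond b + t"]) auto
  qed
qed

text \<open>\<open>N\<close> bounds the variant \<open>f\<close> and hence the number of turns; the
  induction spends one unit of it per turn.\<close>

lemma hoare_while:
  assumes safe: "\<And>R M out. I R M out \<Longrightarrow> safe_cond w m T (R, M, out) b"
    and body: "\<And>z. hoare (\<lambda>R M out. I R M out \<and> holds r T (R, M, out) b \<and> f R = z) c t
      (\<lambda>R M out. I R M out \<and> f R < z)"
  shows "hoare (\<lambda>R M out. I R M out \<and> f R \<le> N) (While b c)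
    (N * (1 + cost_cond b + t) + (1 + cost_cond b)) (\<lambda>R M out. I R M out \<and>
        \<not> holds r T (R, M, out) b)"
proof (induction N rule: less_induct)
  case (less N)
  show ?case
    unfolding hoare_def
  proof (intro allI impI, elim conjE)
    fix R M out assume I: "I R M out" and N: "f R \<le> N"
    show "\<exists>t' R' M' out'. t' \<le> N * (1 + cost_cond b + t) + (1 + cost_cond b) \<and>
      run r w m T (While b c) (R, M, out) t' (R', M', out') \<and>
      I R' M' out' \<and> \<not> holds r T (R', M', out') b"
    proof (cases "holds r T (R, M, out) b")
      case False
      then show ?thesis using run_WhileFalse[OF safe[OF I] False] I
        by (intro exI[of _ "1 + cost_cond b"]) auto
    next
      case True
      from body[of "f R"] I True obtain t1 R1 M1 out1 where 1: "t1 \<le> t"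
        "run r w m T c (R, M, out) t1 (R1, M1, out1)" "I R1 M1 out1" "f R1 < f R"
        unfolding hoare_def by blast
      then obtain N' where N': "N = Suc N'" "f R1 \<le> N'" using N by (cases N) auto
      from less[of N'] N' 1(3) obtain t2 R2 M2 out2 where 2:
        "t2 \<le> N' * (1 + cost_cond b + t) + (1 + cost_cond b)"
        "run r w m T (While b c) (R1, M1, out1) t2 (R2, M2, out2)"
        "I R2 M2 out2" "\<not> holds r T (R2, M2, out2) b"
        unfolding hoare_def by blast
      have "1 + cost_cond b + t1 + t2 \<le> N * (1 + cost_cond b + t) + (1 + cost_cond b)"
        using 1(1) 2(1) N'(1) by simp
      then show ?thesis using run_WhileTrue[OF safe[OF I] True 1(2) 2(2)] 2(3,4) by blast
    qed
  qed
qed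

text \<open>\<open>4 * n\<close> comes from \<open>opt_bound\<close>; the surplus covers the 3 or 4
  added for a match, incremented indices and constants.\<close>

lemma small_lt_word: "v \<le> 4 * n + 8 \<Longrightarrow> v < 2 ^ w"
proof -
  assume "v \<le> 4 * n + 8"
  also have "4 * n + 8 < (n + 2) * 2 ^ 7" by simp
  also have "\<dots> \<le> (n + 2) * (n + 2) ^ 7" by (intro mult_left_mono power_mono) auto
  also have "\<dots> = (n + 2) ^ 8" by (simp add: power_Suc[symmetric] del: power_Suc)
  finally show ?thesis using word by simp
qed

text \<open>\<open>I v\<close> describes the state when the values from \<open>v\<close> on are
  done, so one turn leads from \<open>I (Suc v)\<close> to \<open>I v\<close>. By
  \<open>indep\<close> the invariant sees the counter only as its parameter, so setting the register
  does not disturb it. Costs are normalised to a constant times a power of \<open>n + 1\<close>: a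
  loop raises the exponent by one and adds 20 and the cost of \<open>e\<close> to the constant, so
  nested loops compose by adding constants.\<close>

lemma hoare_for:
  assumes body: "\<And>v. v < N \<Longrightarrow>
      hoare (\<lambda>R M out. I (Suc v) R M out \<and> R x = v) c (K * (n + 1) ^ d) (\<lambda>R M out. I v R M out \<and>
          R x = v)"
    and indep: "\<And>v y R M out. I v (R(x := y)) M out = I v R M out"
    and bound: "\<And>R M out. safe w m T (R, M, out) e \<and> val T (R, M, out) e = N" "N \<le> n + 1"
  shows "hoare (I N) (for_down x e c) ((K + 20 + cost_exp e) * (n + 1) ^ Suc d) (I 0)"
proof -
  let ?I = "\<lambda>R M out. I (R x) R M out \<and> R x \<le> N"
  have init: "hoare (I N) (Assign x e) (time_bound (Assign x e)) (\<lambda>R M out. ?I R M out \<and> R x \<le> N)"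
    by (rule hoare_wp) (use bound in \<open>simp add: indep\<close>)
  have one: "(1::nat) < 2 ^ w" by (rule small_lt_word) simp
  have step: "hoare (\<lambda>R M out. ?I R M out \<and> holds r T (R, M, out) (Less (Const 0) (Reg x)) \<and> R x =
      z)
      (Seq (Assign x (Sub (Reg x) (Const 1))) c) (4 + K * (n + 1) ^ d) (\<lambda>R M out. ?I R M out \<and>
          R x < z)" for z
  proof (cases "z = 0 \<or> z > N")
    \<comment> \<open>Such \<open>z\<close> contradict the guard or the bound on the counter, so the
      triple is vacuous.\<close>
    case True
    then show ?thesis unfolding hoare_def by auto
  next
    case False
    then obtain v where v: "z = Suc v" "v < N" by (cases z) auto
    have "hoare (\<lambda>R M out. ?I R M out \<and> holds r T (R, M, out) (Less (Const 0) (Reg x)) \<and> R x = z)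
      (Assign x (Sub (Reg x) (Const 1))) (time_bound (Assign x (Sub (Reg x) (Const 1))))
      (\<lambda>R M out. I (Suc v) R M out \<and> R x = v)"
      by (rule hoare_wp) (use v one in \<open>auto simp: indep\<close>)
    from hoare_seq[OF this body[OF v(2)]] show ?thesis
      by (rule hoare_conseq) (use v in auto)
  qed
  have "hoare ?I (While (Less (Const 0) (Reg x)) (Seq (Assign x (Sub (Reg x) (Const 1))) c))
      (N * (1 + cost_cond (Less (Const 0) (Reg x)) + (4 + K * (n + 1) ^ d)) + (1 + cost_cond (Less
          (Const 0) (Reg x))))
      (\<lambda>R M out. ?I R M out \<and> \<not> holds r T (R, M, out) (Less (Const 0) (Reg x)))"
    using one by (intro hoare_conseq[OF hoare_while[where I = ?I and f = "\<lambda>R. R x"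
        and N = N, OF _ step]]) auto
  then have while: "hoare (\<lambda>R M out. ?I R M out \<and> R x \<le> N) (While (Less (Const 0) (Reg x)) (Seq
      (Assign x (Sub (Reg x) (Const 1))) c))
      (N * (8 + K * (n + 1) ^ d) + 4) (I 0)"
    by (rule hoare_conseq) auto
  have "N * (8 + K * (n + 1) ^ d) + 4 \<le> (n + 1) * (8 + K * (n + 1) ^ d) + 4"
    using bound(2) by (intro add_mono mult_right_mono) auto
  also have "\<dots> = K * (n + 1) ^ Suc d + (8 * (n + 1) + 4)" by (simp add: algebra_simps)
  finally have "time_bound (Assign x e) + (N * (8 + K * (n + 1) ^ d) + 4) \<le>
      K * (n + 1) ^ Suc d + (8 * (n + 1) + 5 + cost_exp e)" by simp
  also have "8 * (n + 1) + 5 + cost_exp e \<le> (20 + cost_exp e) * (n + 1)"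
      by (simp add: algebra_simps)
  also have "\<dots> \<le> (20 + cost_exp e) * (n + 1) ^ Suc d"
    by (intro mult_left_mono self_le_power) simp_all
  finally have "time_bound (Assign x e) + (N * (8 + K * (n + 1) ^ d) + 4) \<le>
      (K + 20 + cost_exp e) * (n + 1) ^ Suc d" by (simp add: algebra_simps)
  from hoare_conseq[OF hoare_seq[OF init while] _ _ this] show ?thesis
    unfolding for_down_def by blast
qed

end

section \<open>The program\<close>

text \<open>Registers: 0--2 hold the starts \<open>a\<close>, \<open>b\<close>, \<open>c\<close> of the second, third and fourth copy, 3--6 the
  indices \<open>i\<close>, \<open>j\<close>, \<open>k\<close>, \<open>l\<close> of the current table cell, 7 the length of the best solution found so
  far, 8--11 the starts of its four copies, 12 is scratch, and 13 is 0 when only the part \<open>V\<close> of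
  \<open>V @ W\<close> is to be written.\<close>

definition addr :: "nat \<Rightarrow> nat \<Rightarrow> nat \<Rightarrow> nat \<Rightarrow> nat \<Rightarrow> nat" where
  "addr B i j k l = ((i * B + j) * B + k) * B + l"

definition addr_exp :: "exp \<Rightarrow> exp \<Rightarrow> exp \<Rightarrow> exp \<Rightarrow> exp" where
  "addr_exp e1 e2 e3 e4 =
    (let B = Add Len (Const 1)
     in Add (Mul (Add (Mul (Add (Mul e1 B) e2) B) e3) B) e4)"

abbreviation cell :: "exp \<Rightarrow> exp \<Rightarrow> exp \<Rightarrow> exp \<Rightarrow> exp" where
  "cell e1 e2 e3 e4 \<equiv> Mem (addr_exp e1 e2 e3 e4)"

abbreviation inc :: "nat \<Rightarrow> exp" where
  "inc x \<equiv> Add (Reg x) (Const 1)"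

definition char_eq :: "nat \<Rightarrow> nat \<Rightarrow> cond" where
  "char_eq x y = And (CharLe (Reg x) (Reg y)) (CharLe (Reg y) (Reg x))"

definition raise_to :: "exp \<Rightarrow> com" where
  "raise_to e = If (Less (Reg 12) e) (Assign 12 e) Skip"

text \<open>Register 12 accumulates the maximum in the recursion of \<open>opt\<close>. The tests on
  the indices also protect the accesses: an index is incremented only where the result stays within
  the table.\<close>

definition fill_cell :: com where
  "fill_cell = Seq
    (If (And (Less (Reg 3) (Reg 0)) (And (Less (Reg 4) (Reg 1)) (Less (Reg 5) (Reg 2))))
      (Seq (Assign 12 (cell (inc 3) (Reg 4) (Reg 5) (Reg 6)))
      (Seq (raise_to (cell (Reg 3) (inc 4) (Reg 5) (Reg 6)))
      (Seq (raise_to (cell (Reg 3) (Reg 4) (inc 5) (Reg 6)))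
        (If (Less (Reg 6) Len)
          (Seq (raise_to (cell (Reg 3) (Reg 4) (Reg 5) (inc 6)))
            (If (And (And (char_eq 3 4) (And (char_eq 3 5) (char_eq 3 6)))
                  (Less (Const 0) (cell (inc 3) (inc 4) (inc 5) (inc 6))))
              (raise_to (Add (Const 4) (cell (inc 3) (inc 4) (inc 5) (inc 6)))) Skip))
          (If (And (char_eq 3 4) (char_eq 3 5))
            (raise_to (Add (Const 3) (cell (inc 3) (inc 4) (inc 5) (Reg 6)))) Skip)))))
      (Assign 12 (Const 0)))
    (Store (addr_exp (Reg 3) (Reg 4) (Reg 5) (Reg 6)) (Reg 12))"

definition fill :: com where
  "fill =
    for_down 3 (Add Len (Const 1)) (for_down 4 (Add Len (Const 1))
      (for_down 5 (Add Len (Const 1)) (for_down 6 (Add Len (Const 1)) fill_cell)))"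

definition compare :: com where
  "compare =
    If (And (And (char_eq 3 0) (And (char_eq 3 1) (char_eq 3 2)))
         (And (Less (Const 0) (cell (inc 3) (inc 0) (inc 1) (inc 2)))
           (Less (Reg 7) (Add (Const 4) (cell (inc 3) (inc 0) (inc 1) (inc 2))))))
      (Seq (Assign 7 (Add (Const 4) (cell (inc 3) (inc 0) (inc 1) (inc 2))))
        (Seq (Assign 8 (Reg 3)) (Seq (Assign 9 (Reg 0)) (Seq (Assign 10 (Reg 1)) (Assign 11 (Reg
            2))))))
      Skip"

definition search :: com where
  "search = for_down 0 Len (for_down 1 Len (for_down 2 Len (Seq fill (for_down 3 Len compare))))"

text \<open>Letters are always written from the first piece, since all pieces match the same letter.
  Register 13 silences only three-way matches, which belong to \<open>W\<close>.\<close>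

definition trace_step :: com where
  "trace_step =
    (let v = cell (Reg 3) (Reg 4) (Reg 5) (Reg 6);
         advance = Seq (Assign 3 (inc 3)) (Seq (Assign 4 (inc 4)) (Assign 5 (inc 5))) in
     If (Eq (cell (inc 3) (Reg 4) (Reg 5) (Reg 6)) v) (Assign 3 (inc 3))
     (If (Eq (cell (Reg 3) (inc 4) (Reg 5) (Reg 6)) v) (Assign 4 (inc 4))
     (If (Eq (cell (Reg 3) (Reg 4) (inc 5) (Reg 6)) v) (Assign 5 (inc 5))
     (If (Less (Reg 6) Len)
       (If (Eq (cell (Reg 3) (Reg 4) (Reg 5) (inc 6)) v) (Assign 6 (inc 6))
         (Seq (Emit (Reg 3)) (Seq advance (Assign 6 (inc 6)))))
       (Seq (If (Less (Const 0) (Reg 13)) (Emit (Reg 3)) Skip) advance)))))"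

text \<open>The pinned first letter is written before the loop, which begins at the cell just behind
  the four starts. Register 8 serves every copy, as the four first letters are equal.\<close>

definition trace_start :: com where
  "trace_start =
    Seq (Emit (Reg 8)) (Seq (Assign 3 (inc 8)) (Seq (Assign 4 (inc 0))
      (Seq (Assign 5 (inc 1)) (Assign 6 (inc 2)))))"

definition trace :: com where
  "trace = Seq trace_start
    (While (Less (Const 0) (cell (Reg 3) (Reg 4) (Reg 5) (Reg 6))) trace_step)"

definition main :: com where
  "main = Seq search
    (If (Less (Const 0) (Reg 7))
      (Seq (Seq (Assign 0 (Reg 9)) (Seq (Assign 1 (Reg 10)) (Assign 2 (Reg 11))))
      (Seq fill
      (Seq (Assign 13 (Const 1))
      (Seq trace (Seq trace (Seq trace
      (Seq (Assign 13 (Const 0)) trace)))))))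
      Skip)"

section \<open>Addresses as four-digit numbers\<close>

lemma addr_Suc: "addr B i j k (Suc l) = Suc (addr B i j k l)"
  by (simp add: addr_def)

text \<open>A digit equal to \<open>B\<close> is a carry. This identifies the invariant at the entry
  of an inner loop, whose index equals the bound there, with that of the enclosing loop at the next
  larger index.\<close>

lemma addr_carry:
  "addr B i j k B = addr B i j (Suc k) 0"
  "addr B i j B 0 = addr B i (Suc j) 0 0"
  "addr B i B 0 0 = addr B (Suc i) 0 0 0"
  by (simp_all add: addr_def algebra_simps)

lemma digit_less:
  fixes x y :: nat
  assumes "x < X" "y < B"
  shows "x * B + y < X * B"
proof -
  have "x * B + y < Suc x * B" using assms by simp
  also have "\<dots> \<le> X * B" using assms by (intro mult_right_mono) auto
  finally show ?thesis .
qed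

lemma addr_less: "i < B \<Longrightarrow> j < B \<Longrightarrow> k < B \<Longrightarrow> l < B \<Longrightarrow> addr B i j k l < B ^ 4"
  using digit_less[OF digit_less[OF digit_less[of i B j B]], of k B l]
  by (simp add: addr_def power4_eq_xxxx mult.assoc)

lemma digit_inj:
  fixes x y x' y' :: nat
  assumes "y < B" "y' < B"
  shows "x * B + y = x' * B + y' \<longleftrightarrow> x = x' \<and> y = y'"
proof
  assume eq: "x * B + y = x' * B + y'"
  have "x = (x * B + y) div B" "y = (x * B + y) mod B"
    "x' = (x' * B + y') div B" "y' = (x' * B + y') mod B" using assms by simp_all
  with eq show "x = x' \<and> y = y'" by metis
qed simp

lemma addr_inj:
  "j < B \<Longrightarrow> k < B \<Longrightarrow> l < B \<Longrightarrow> j' < B \<Longrightarrow> k' < B \<Longrightarrow> l' < B \<Longrightarrow>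
    addr B i j k l = addr B i' j' k' l' \<longleftrightarrow> i = i' \<and> j = j' \<and> k = k' \<and> l = l'"
  by (simp add: addr_def digit_inj)

context ram
begin

lemma val_addr_exp [simp]:
  "val T \<sigma> (addr_exp e1 e2 e3 e4) = addr (n + 1) (val T \<sigma> e1) (val T \<sigma> e2) (val T \<sigma> e3) (val T \<sigma>
      e4)"
  by (simp add: addr_exp_def addr_def Let_def)

lemma addr_less_cells: "i \<le> n \<Longrightarrow> j \<le> n \<Longrightarrow> k \<le> n \<Longrightarrow> l \<le> n \<Longrightarrow> addr (n + 1) i j k l < m"
  unfolding cells by (rule addr_less) auto

lemma cells_le_word: "m \<le> 2 ^ w"
proof -
  have "m \<le> (n + 2) ^ 4" unfolding cells by (rule power_mono) auto
  also have "\<dots> \<le> (n + 2) ^ 8" by (rule power_increasing) auto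
  finally show ?thesis using word by simp
qed

text \<open>Every intermediate value of the Horner evaluation is at most the final address, which is
  a valid cell and so fits into a word.\<close>

lemma safe_addr_exp [simp]:
  assumes "safe w m T \<sigma> e1" "safe w m T \<sigma> e2" "safe w m T \<sigma> e3" "safe w m T \<sigma> e4"
    "val T \<sigma> e1 \<le> n" "val T \<sigma> e2 \<le> n" "val T \<sigma> e3 \<le> n" "val T \<sigma> e4 \<le> n"
  shows "safe w m T \<sigma> (addr_exp e1 e2 e3 e4)"
proof -
  let ?B = "n + 1"
  define i j k l where "i = val T \<sigma> e1" "j = val T \<sigma> e2" "k = val T \<sigma> e3" "l = val T \<sigma> e4"
  note defs = i_j_k_l_def
  have le: "x \<le> x * ?B" for x :: nat by simp
  have total: "((i * ?B + j) * ?B + k) * ?B + l < 2 ^ w"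
    using addr_less_cells[OF assms(5-8)] cells_le_word unfolding addr_def defs by linarith
  then have "((i * ?B + j) * ?B + k) * ?B < 2 ^ w" by linarith
  then have "(i * ?B + j) * ?B + k < 2 ^ w" using le le_less_trans by blast
  then have "(i * ?B + j) * ?B < 2 ^ w" by linarith
  then have "i * ?B + j < 2 ^ w" using le le_less_trans by blast
  then have "i * ?B < 2 ^ w" by linarith
  note bounds = total \<open>((i * ?B + j) * ?B + k) * ?B < 2 ^ w\<close> \<open>(i * ?B + j) * ?B + k < 2 ^ w\<close>
    \<open>(i * ?B + j) * ?B < 2 ^ w\<close> \<open>i * ?B + j < 2 ^ w\<close> this
  have "?B < 2 ^ w" "1 < (2::nat) ^ w" "n < 2 ^ w" by (auto intro!: small_lt_word)
  with bounds assms show ?thesis unfolding defs by (simp add: addr_exp_def Let_def)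
qed

lemma addr_less_cells' [simp]:
  "i \<le> n \<Longrightarrow> j \<le> n \<Longrightarrow> k \<le> n \<Longrightarrow> l \<le> n \<Longrightarrow> addr (Suc n) i j k l < m"
  using addr_less_cells by simp

text \<open>The machine only offers order comparisons; equality is two of them, by antisymmetry, and
  reflexivity on the alphabet gives the converse.\<close>

lemma holds_char_eq [simp]:
  assumes "R x < n" "R y < n"
  shows "holds r T (R, M, out) (char_eq x y) \<longleftrightarrow> T ! R x = T ! R y"
proof -
  have "T ! R x \<in> \<Sigma>" "T ! R y \<in> \<Sigma>" using alphabet assms nth_mem by blast+
  moreover have "refl_on \<Sigma> r" "antisym r"
    using lin by (auto simp: order_on_defs)
  ultimately have "(T ! R x, T ! R y) \<in> r \<and> (T ! R y, T ! R x) \<in> r \<longleftrightarrow> T ! R x = T ! R y"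
    by (metis antisymD refl_onD)
  then show ?thesis by (simp add: char_eq_def)
qed

lemma safe_char_eq [simp]: "R x < n \<Longrightarrow> R y < n \<Longrightarrow> safe_cond w m T (R, M, out) (char_eq x y)"
  by (simp add: char_eq_def)

lemma word_sizes [simp]:
  "n < 2 ^ w" "Suc 0 < 2 ^ w" "3 < (2::nat) ^ w" "4 < (2::nat) ^ w" "x \<le> n \<Longrightarrow> Suc x < 2 ^ w"
  by (rule small_lt_word; simp)+

lemma wp_if_true:
  "safe_cond w m T (R, M, out) b \<Longrightarrow> holds r T (R, M, out) b \<Longrightarrow> wp c1 Q R M out \<Longrightarrow>
    wp (If b c1 c2) Q R M out"
  by simp

lemma wp_if_false:
  "safe_cond w m T (R, M, out) b \<Longrightarrow> \<not> holds r T (R, M, out) b \<Longrightarrow> wp c2 Q R M out \<Longrightarrow>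
    wp (If b c1 c2) Q R M out"
  by simp

lemma wp_raise_to [simp]:
  "wp (raise_to e) Q R M out \<longleftrightarrow> safe w m T (R, M, out) e \<and>
    Q (R(12 := max (R 12) (val T (R, M, out) e))) M out"
  by (auto simp: raise_to_def max_def)

section \<open>Contents of the memory table\<close>

text \<open>The downward loops visit the cells by decreasing address, so the single number
  \<open>q\<close> records the progress of all four: the cells from \<open>q\<close> on are final,
  the others may hold anything.\<close>

definition table :: "nat \<Rightarrow> nat \<Rightarrow> nat \<Rightarrow> nat \<Rightarrow> (nat \<Rightarrow> nat) \<Rightarrow> bool" where
  "table a b c q M \<longleftrightarrow> (\<forall>i j k l. i \<le> n \<and> j \<le> n \<and> k \<le> n \<and> l \<le> n \<and> q \<le> addr (Suc n) i j k l \<longrightarrow>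
     M (addr (Suc n) i j k l) = opt T a b c i j k l)"

lemma table_step:
  assumes "table a b c (Suc (addr (Suc n) i j k l)) M" "i \<le> n" "j \<le> n" "k \<le> n" "l \<le> n"
  shows "table a b c (addr (Suc n) i j k l) (M(addr (Suc n) i j k l := opt T a b c i j k l))"
  unfolding table_def
proof (intro allI impI, elim conjE)
  fix i' j' k' l'
  assume digits: "i' \<le> n" "j' \<le> n" "k' \<le> n" "l' \<le> n"
    and le: "addr (Suc n) i j k l \<le> addr (Suc n) i' j' k' l'"
  show "(M(addr (Suc n) i j k l := opt T a b c i j k l)) (addr (Suc n) i' j' k' l') =
      opt T a b c i' j' k' l'"
  proof (cases "addr (Suc n) i' j' k' l' = addr (Suc n) i j k l")
    case True
    then have "i' = i \<and> j' = j \<and> k' = k \<and> l' = l"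
      using digits assms(3-5) by (subst (asm) addr_inj) auto
    then show ?thesis by simp
  next
    case False
    with le have "Suc (addr (Suc n) i j k l) \<le> addr (Suc n) i' j' k' l'" by linarith
    then have "M (addr (Suc n) i' j' k' l') = opt T a b c i' j' k' l'"
      using assms(1) digits unfolding table_def by blast
    with False show ?thesis by simp
  qed
qed

lemma table_get:
  "table a b c q M \<Longrightarrow> i \<le> n \<Longrightarrow> j \<le> n \<Longrightarrow> k \<le> n \<Longrightarrow> l \<le> n \<Longrightarrow> q \<le> addr (Suc n) i j k l \<Longrightarrow>
    M (addr (Suc n) i j k l) = opt T a b c i j k l"
  unfolding table_def by blast

text \<open>The registers that \<open>fill\<close> must preserve: all except its loop counters 3 to
  6 and the scratch register 12.\<close>

abbreviation kept :: "(nat \<Rightarrow> nat) \<Rightarrow> nat list" where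
  "kept R \<equiv> map R [0, 1, 2, 7, 8, 9, 10, 11, 13]"

text \<open>Cells read for the recursion have some indices incremented and none decreased; their
  addresses are larger, so they have been filled before.\<close>

lemma addr_strict_mono:
  assumes "i \<le> i'" "j \<le> j'" "k \<le> k'" "l \<le> l'" "i < i' \<or> j < j' \<or> k < k' \<or> l < l'"
  shows "Suc (addr (Suc n) i j k l) \<le> addr (Suc n) i' j' k' l'"
proof -
  have step: "x * Suc n + y < x' * Suc n + y'" if "x \<le> x'" "y \<le> y'" "x < x' \<or> y < y'"
    for x y x' y' :: nat
  proof (cases "x < x'")
    case True
    then have "x * Suc n < x' * Suc n" by (rule mult_less_mono1) simp
    with that(2) show ?thesis by linarith
  next
    case False
    then show ?thesis using that by simp
  qed
  have step': "x * Suc n + y \<le> x' * Suc n + y'" if "x \<le> x'" "y \<le> y'" for x y x' y' :: nat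
    using that by (intro add_mono mult_le_mono1)
  have 1: "i * Suc n + j \<le> i' * Suc n + j'" using assms by (intro step')
  have 2: "(i * Suc n + j) * Suc n + k \<le> (i' * Suc n + j') * Suc n + k'"
    using 1 assms(3) by (rule step')
  consider "i < i' \<or> j < j'" | "k < k'" | "l < l'" using assms(5) by blast
  then have "((i * Suc n + j) * Suc n + k) * Suc n + l < ((i' * Suc n + j') * Suc n + k') * Suc n
      + l'"
  proof cases
    case 1
    then have "i * Suc n + j < i' * Suc n + j'" using assms(1,2) by (intro step)
    then have "(i * Suc n + j) * Suc n + k < (i' * Suc n + j') * Suc n + k'"
      using assms(3) by (intro step) auto
    then show ?thesis using assms(4) by (intro step) auto
  next
    case k: 2
    then have "(i * Suc n + j) * Suc n + k < (i' * Suc n + j') * Suc n + k'"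
      using 1 assms(3) by (intro step) auto
    then show ?thesis using assms(4) by (intro step) auto
  next
    case 3
    then show ?thesis using 2 assms(4) by (intro step) auto
  qed
  then show ?thesis unfolding addr_def by simp
qed

text \<open>\<open>V\<close> stands here for the list of values of the registers 7 to 11 and 13, not
  for a string.\<close>

lemma fill_cell_correct:
  assumes "a \<le> n" "b \<le> n" "c \<le> n" "i \<le> n" "j \<le> n" "k \<le> n" "l \<le> n"
  shows "hoare (\<lambda>R M out. table a b c (Suc (addr (Suc n) i j k l)) M \<and>
        kept R = a # b # c # V \<and> out = o' \<and> R 3 = i \<and> R 4 = j \<and> R 5 = k \<and> R 6 = l)
      fill_cell (time_bound fill_cell)
      (\<lambda>R M out. table a b c (addr (Suc n) i j k l) M \<and>
        kept R = a # b # c # V \<and> out = o' \<and> R 3 = i \<and> R 4 = j \<and> R 5 = k \<and> R 6 = l)"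
proof (rule hoare_wp, elim conjE)
  fix R M out
  assume tab: "table a b c (Suc (addr (Suc n) i j k l)) M"
    and keep: "kept R = a # b # c # V" and out: "out = o'"
    and idx: "R 3 = i" "R 4 = j" "R 5 = k" "R 6 = l"
  have R: "R 0 = a" "R (Suc 0) = b" "R 2 = c" using keep by auto
  note step = table_step[OF tab assms(4-7)]
  have get: "M (addr (Suc n) i' j' k' l') = opt T a b c i' j' k' l'"
    if "i \<le> i'" "j \<le> j'" "k \<le> k'" "l \<le> l'" "i < i' \<or> j < j' \<or> k < k' \<or> l < l'"
      "i' \<le> n" "j' \<le> n" "k' \<le> n" "l' \<le> n" for i' j' k' l'
    using tab that by (intro table_get[OF tab] addr_strict_mono)
  have bound: "opt T a b c i' j' k' l' + 4 < 2 ^ w" for i' j' k' l'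
    using opt_bound[of T a b c i' j' k' l'] assms(1) by (intro small_lt_word) simp
  have bound': "opt T a b c i' j' k' l' + 3 < 2 ^ w" for i' j' k' l'
    using bound[of i' j' k' l'] by simp
  let ?Q = "\<lambda>R M out. table a b c (addr (Suc n) i j k l) M \<and>
        kept R = a # b # c # V \<and> out = o' \<and> R 3 = i \<and> R 4 = j \<and> R 5 = k \<and> R 6 = l"
  let ?K = "wp (Store (addr_exp (Reg 3) (Reg 4) (Reg 5) (Reg 6)) (Reg 12)) ?Q"
  let ?x = "\<lambda>z. (R(12 := z), M, out)"
  have store: "wp (Store (addr_exp (Reg 3) (Reg 4) (Reg 5) (Reg 6)) (Reg 12)) ?Q (R(12 := z)) M out"
    if "z = opt T a b c i j k l" for z
    using step keep out idx that assms by simp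
  have guard: "safe_cond w m T (R, M, out)
        (And (Less (Reg 3) (Reg 0)) (And (Less (Reg 4) (Reg 1)) (Less (Reg 5) (Reg 2))))"
    "holds r T (R, M, out)
        (And (Less (Reg 3) (Reg 0)) (And (Less (Reg 4) (Reg 1)) (Less (Reg 5) (Reg 2)))) \<longleftrightarrow>
      i < a \<and> j < b \<and> k < c"
    using R idx by simp_all
  have len: "safe_cond w m T (?x z) (Less (Reg 6) Len)" "holds r T (?x z) (Less (Reg 6) Len) \<longleftrightarrow>
      l < n" for z
    using idx by simp_all
  note wps = wp.simps(1,2,5) wp_raise_to fun_upd_upd fun_upd_same simp_thms
  show "wp fill_cell ?Q R M out"
  proof (cases "i < a \<and> j < b \<and> k < c")
    case False
    then have "opt T a b c i j k l = 0" by (rule opt_out_of_range)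
    moreover have "safe w m T (R, M, out) (Const 0)" "val T (R, M, out) (Const 0) = 0" by simp_all
    ultimately have "wp (Assign 12 (Const 0))
        (wp (Store (addr_exp (Reg 3) (Reg 4) (Reg 5) (Reg 6)) (Reg 12)) ?Q) R M out"
      using store[of 0] by (simp only: wp.simps(2) simp_thms)
    with guard False show ?thesis
      unfolding fill_cell_def wp.simps(5) by (intro wp_if_false) (simp_all only: simp_thms)
  next
    case True
    then have less: "i < n" "j < n" "k < n" using assms by auto
    \<comment> \<open>Register 12 occurs in no address, so the later reads are the same whatever
      maximum \<open>z\<close> it holds so far.\<close>
    have skip: "safe w m T (R, M, out) (cell (inc 3) (Reg 4) (Reg 5) (Reg 6))"
      "val T (R, M, out) (cell (inc 3) (Reg 4) (Reg 5) (Reg 6)) = opt T a b c (Suc i) j k l"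
      "safe w m T (?x z) (cell (Reg 3) (inc 4) (Reg 5) (Reg 6))"
      "val T (?x z) (cell (Reg 3) (inc 4) (Reg 5) (Reg 6)) = opt T a b c i (Suc j) k l"
      "safe w m T (?x z) (cell (Reg 3) (Reg 4) (inc 5) (Reg 6))"
      "val T (?x z) (cell (Reg 3) (Reg 4) (inc 5) (Reg 6)) = opt T a b c i j (Suc k) l" for z
      using less idx assms by (simp_all add: get)
    let ?z2 = "max (max (opt T a b c (Suc i) j k l) (opt T a b c i (Suc j) k l)) (opt T a b c i j
        (Suc k) l)"
    let ?z3 = "max ?z2"
    have fill: "wp fill_cell ?Q R M out" if "wp (If (Less (Reg 6) Len)
          (Seq (raise_to (cell (Reg 3) (Reg 4) (Reg 5) (inc 6)))
            (If (And (And (char_eq 3 4) (And (char_eq 3 5) (char_eq 3 6)))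
                  (Less (Const 0) (cell (inc 3) (inc 4) (inc 5) (inc 6))))
              (raise_to (Add (Const 4) (cell (inc 3) (inc 4) (inc 5) (inc 6)))) Skip))
          (If (And (char_eq 3 4) (char_eq 3 5))
            (raise_to (Add (Const 3) (cell (inc 3) (inc 4) (inc 5) (Reg 6)))) Skip)) ?K (R(12 :=
                ?z2)) M out"
      unfolding fill_cell_def wp.simps(5)
      by (intro wp_if_true guard(1) guard(2)[THEN iffD2, OF True]) (simp only: wps skip that)
    show ?thesis
    proof (cases "l < n")
      case l: True
      let ?c = "And (And (char_eq 3 4) (And (char_eq 3 5) (char_eq 3 6)))
        (Less (Const 0) (cell (inc 3) (inc 4) (inc 5) (inc 6)))"
      have skip_l: "safe w m T (?x z) (cell (Reg 3) (Reg 4) (Reg 5) (inc 6))"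
        "val T (?x z) (cell (Reg 3) (Reg 4) (Reg 5) (inc 6)) = opt T a b c i j k (Suc l)" for z
        using less l idx assms by (simp_all add: get)
      have match: "safe w m T (?x z) (Add (Const 4) (cell (inc 3) (inc 4) (inc 5) (inc 6)))"
        "val T (?x z) (Add (Const 4) (cell (inc 3) (inc 4) (inc 5) (inc 6))) =
          4 + opt T a b c (Suc i) (Suc j) (Suc k) (Suc l)"
        "safe_cond w m T (?x z) ?c"
        "holds r T (?x z) ?c \<longleftrightarrow> T ! i = T ! j \<and> T ! i = T ! k \<and> T ! i = T ! l \<and>
          0 < opt T a b c (Suc i) (Suc j) (Suc k) (Suc l)" for z
        using less l idx assms bound[of "Suc i" "Suc j" "Suc k" "Suc l"]
        by (simp_all add: get add.commute)
      have eq: "opt T a b c i j k l = max (max (max (max (opt T a b c (Suc i) j k l) (opt T a b c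
          i (Suc j) k l))
           (opt T a b c i j (Suc k) l)) (opt T a b c i j k (Suc l)))
           (if T ! i = T ! j \<and> T ! i = T ! k \<and> T ! i = T ! l \<and>
               0 < opt T a b c (Suc i) (Suc j) (Suc k) (Suc l)
            then 4 + opt T a b c (Suc i) (Suc j) (Suc k) (Suc l) else 0)"
        using True l by (subst opt.simps) simp
      have "wp (If ?c (raise_to (Add (Const 4) (cell (inc 3) (inc 4) (inc 5) (inc 6)))) Skip) ?K
        (R(12 := ?z3 (opt T a b c i j k (Suc l)))) M out"
      proof (cases "holds r T (?x (?z3 (opt T a b c i j k (Suc l)))) ?c")
        case True
        note eq' = eq[unfolded if_P[OF True[unfolded match(4)]], symmetric]
        show ?thesis
          by (intro wp_if_true[OF match(3) True]) (simp only: wps match(1,2) store[OF eq'])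
      next
        case False
        note eq' = eq[unfolded if_not_P[OF False[unfolded match(4)]] max_0R, symmetric]
        \<comment> \<open>A failed match contributes 0 to the recursion, which \<open>max_0R\<close>
          has removed from \<open>eq'\<close>; register 12 is already final.\<close>
        show ?thesis
          by (intro wp_if_false[OF match(3) False]) (simp only: wps store[OF eq'])
      qed
      then have "wp (Seq (raise_to (cell (Reg 3) (Reg 4) (Reg 5) (inc 6)))
          (If ?c (raise_to (Add (Const 4) (cell (inc 3) (inc 4) (inc 5) (inc 6)))) Skip)) ?K (R(12
              := ?z2)) M out"
        by (simp only: wps skip_l)
      then show ?thesis by (intro fill wp_if_true len(1) len(2)[THEN iffD2] l)
    next
      case l: False
      let ?c = "And (char_eq 3 4) (char_eq 3 5)"
      have match: "safe w m T (?x z) (Add (Const 3) (cell (inc 3) (inc 4) (inc 5) (Reg 6)))"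
        "val T (?x z) (Add (Const 3) (cell (inc 3) (inc 4) (inc 5) (Reg 6))) =
          3 + opt T a b c (Suc i) (Suc j) (Suc k) l"
        "safe_cond w m T (?x z) ?c"
        "holds r T (?x z) ?c \<longleftrightarrow> T ! i = T ! j \<and> T ! i = T ! k" for z
        using less idx assms bound'[of "Suc i" "Suc j" "Suc k" l]
        by (simp_all add: get add.commute)
      have eq: "opt T a b c i j k l = max (max (max (opt T a b c (Suc i) j k l) (opt T a b c i
          (Suc j) k l))
           (opt T a b c i j (Suc k) l))
           (if T ! i = T ! j \<and> T ! i = T ! k then 3 + opt T a b c (Suc i) (Suc j) (Suc k) l else 0)"
        using True l by (subst opt.simps) simp
      have "wp (If ?c (raise_to (Add (Const 3) (cell (inc 3) (inc 4) (inc 5) (Reg 6)))) Skip) ?K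
        (R(12 := ?z2)) M out"
      proof (cases "holds r T (?x ?z2) ?c")
        case True
        note eq' = eq[unfolded if_P[OF True[unfolded match(4)]], symmetric]
        show ?thesis
          by (intro wp_if_true[OF match(3) True]) (simp only: wps match(1,2) store[OF eq'])
      next
        case False
        note eq' = eq[unfolded if_not_P[OF False[unfolded match(4)]] max_0R, symmetric]
        show ?thesis
          by (intro wp_if_false[OF match(3) False]) (simp only: wps store[OF eq'])
      qed
      moreover have "\<not> holds r T (?x ?z2) (Less (Reg 6) Len)" using len(2) l by blast
      ultimately show ?thesis by (intro fill[OF wp_if_false[OF len(1)]])
    qed
  qed
qed

end

section \<open>Filling the table and searching over the starts\<close>

text \<open>92 = 4 * (20 + 3): four applications of \<open>hoare_for\<close>, with a bound
  expression of cost 3.\<close>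

definition fill_time :: nat where
  "fill_time = time_bound fill_cell + 92"

text \<open>84 = 4 * (20 + 1): the three outer loops and the loop around \<open>compare\<close>,
  each with the bound \<open>Len\<close> of cost 1.\<close>

definition search_time :: nat where
  "search_time = fill_time + time_bound compare + 84"

lemma addr_zero: "addr B 0 0 0 0 = 0"
  by (simp add: addr_def)

context ram
begin

lemma bound_suc: "safe w m T \<sigma> (Add Len (Const 1)) \<and> val T \<sigma> (Add Len (Const 1)) = Suc n"
  by simp

lemma fill_correct:
  assumes abc: "a \<le> n" "b \<le> n" "c \<le> n"
  shows "hoare (\<lambda>R M out. kept R = a # b # c # V \<and> out = o')
      fill (fill_time * (n + 1) ^ 4)
      (\<lambda>R M out. table a b c 0 M \<and> kept R = a # b # c # V \<and> out = o')"
proof -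
  let ?e = "Add Len (Const 1)" and ?t = "time_bound fill_cell"
  have l: "hoare (\<lambda>R M out. table a b c (addr (Suc n) i j (Suc k) 0) M \<and> kept R = a # b # c # V \<and>
      out = o' \<and>
        R 3 = i \<and> R 4 = j \<and> R 5 = k)
      (for_down 6 ?e fill_cell) ((?t + 20 + cost_exp ?e) * (n + 1) ^ Suc 0)
      (\<lambda>R M out. table a b c (addr (Suc n) i j k 0) M \<and> kept R = a # b # c # V \<and> out = o' \<and>
        R 3 = i \<and> R 4 = j \<and> R 5 = k)" if "i \<le> n" "j \<le> n" "k \<le> n" for i j k
  proof -
    let ?I = "\<lambda>v R M out. table a b c (addr (Suc n) i j k v) M \<and> kept R = a # b # c # V \<and> out = o' \<and>
          R 3 = i \<and> R 4 = j \<and> R 5 = k"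
    have "hoare (\<lambda>R M out. ?I (Suc v) R M out \<and> R 6 = v) fill_cell (?t * (n + 1) ^ 0)
        (\<lambda>R M out. ?I v R M out \<and> R 6 = v)" if "v < Suc n" for v
      using that \<open>i \<le> n\<close> \<open>j \<le> n\<close> \<open>k \<le> n\<close>
      by (intro hoare_conseq[OF fill_cell_correct[OF abc, of i j k v V o']]) (simp_all add:
          addr_Suc)
    then show ?thesis
      unfolding addr_carry(1)[symmetric]
      by (rule hoare_for[where I = ?I]) (simp_all only: bound_suc simp_thms, simp_all)
  qed
  have k: "hoare (\<lambda>R M out. table a b c (addr (Suc n) i (Suc j) 0 0) M \<and> kept R = a # b # c # V \<and>
      out = o' \<and>
        R 3 = i \<and> R 4 = j)
      (for_down 5 ?e (for_down 6 ?e fill_cell)) ((?t + 20 + cost_exp ?e + 20 + cost_exp ?e) * (n +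
          1) ^ Suc (Suc 0))
      (\<lambda>R M out. table a b c (addr (Suc n) i j 0 0) M \<and> kept R = a # b # c # V \<and> out = o' \<and>
        R 3 = i \<and> R 4 = j)" if "i \<le> n" "j \<le> n" for i j
    unfolding addr_carry(2)[symmetric]
    by (rule hoare_for[where N = "Suc n" and x = 5 and e = ?e and d = "Suc 0"
        and I = "\<lambda>v R M out. table a b c (addr (Suc n) i j v 0) M \<and> kept R = a # b # c # V \<and> out =
            o' \<and>
          R 3 = i \<and> R 4 = j", OF hoare_conseq[OF l[OF that]]])
      (simp_all only: bound_suc simp_thms, auto)
  have j: "hoare (\<lambda>R M out. table a b c (addr (Suc n) (Suc i) 0 0 0) M \<and> kept R = a # b # c # V \<and>
      out = o' \<and> R 3 = i)
      (for_down 4 ?e (for_down 5 ?e (for_down 6 ?e fill_cell)))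
      ((?t + 20 + cost_exp ?e + 20 + cost_exp ?e + 20 + cost_exp ?e) * (n + 1) ^ Suc (Suc (Suc 0)))
      (\<lambda>R M out. table a b c (addr (Suc n) i 0 0 0) M \<and> kept R = a # b # c # V \<and> out = o' \<and> R 3 =
          i)"
    if "i \<le> n" for i
    unfolding addr_carry(3)[symmetric]
    by (rule hoare_for[where N = "Suc n" and x = 4 and e = ?e and d = "Suc (Suc 0)"
        and I = "\<lambda>v R M out. table a b c (addr (Suc n) i v 0 0) M \<and> kept R = a # b # c # V \<and> out =
            o' \<and> R 3 = i",
        OF hoare_conseq[OF k[OF that]]])
      (simp_all only: bound_suc simp_thms, auto)
  have i: "hoare (\<lambda>R M out. table a b c (addr (Suc n) (Suc n) 0 0 0) M \<and> kept R = a # b # c # V \<and>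
      out = o') fill
      ((?t + 20 + cost_exp ?e + 20 + cost_exp ?e + 20 + cost_exp ?e + 20 + cost_exp ?e) * (n + 1)
          ^ Suc (Suc (Suc (Suc 0))))
      (\<lambda>R M out. table a b c (addr (Suc n) 0 0 0 0) M \<and> kept R = a # b # c # V \<and> out = o')"
    unfolding fill_def
    by (rule hoare_for[where N = "Suc n" and x = 3 and e = ?e and d = "Suc (Suc (Suc 0))"
        and I = "\<lambda>v R M out. table a b c (addr (Suc n) v 0 0 0) M \<and> kept R = a # b # c # V \<and> out =
            o'",
        OF hoare_conseq[OF j]])
      (simp_all only: bound_suc simp_thms, auto)
  \<comment> \<open>This address is \<open>(n + 1) ^ 4\<close>, beyond every cell, so nothing is
    claimed of the initial memory, which may hold the previous table.\<close>
  have empty: "table a b c (addr (Suc n) (Suc n) 0 0 0) M" for M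
  proof -
    have "\<not> addr (Suc n) (Suc n) 0 0 0 \<le> addr (Suc n) i j k l" if "i \<le> n" "j \<le> n" "k \<le> n" "l \<le> n"
        for i j k l
      using addr_less[of i "Suc n" j k l] that by (simp add: addr_def power4_eq_xxxx algebra_simps)
    then show ?thesis unfolding table_def by blast
  qed
  show ?thesis
    by (rule hoare_conseq[OF i]) (auto simp: empty addr_zero fill_time_def numeral_eq_Suc)
qed

text \<open>The quadruples \<open>(a, b, c, i)\<close> are visited in decreasing lexicographic order, that is,
    by decreasing
  address; those from \<open>q\<close> on have been visited.\<close>

definition best_from :: "nat \<Rightarrow> (nat \<Rightarrow> nat) \<Rightarrow> bool" where
  "best_from q R \<longleftrightarrow>
    (R 7 = 0 \<or> R 8 < n \<and> R 9 < n \<and> R 10 < n \<and> R 11 < n \<and> R 7 =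
        candidate T (R 9) (R 10) (R 11) (R 8)) \<and>
    (\<forall>a b c i. a < n \<and> b < n \<and> c < n \<and> i < n \<and> q \<le> addr n a b c i \<longrightarrow> candidate T a b c i \<le> R 7)"

lemma best_from_cong:
  "R 7 = R' 7 \<Longrightarrow> R 8 = R' 8 \<Longrightarrow> R 9 = R' 9 \<Longrightarrow> R 10 = R' 10 \<Longrightarrow> R 11 = R' 11 \<Longrightarrow>
    best_from q R = best_from q R'"
  by (simp add: best_from_def)

lemma best_from_step:
  assumes "best_from (addr n a b c (Suc i)) R" "a < n" "b < n" "c < n" "i < n"
    and "R 7 \<le> R' 7" "candidate T a b c i \<le> R' 7"
    and "R' 7 = 0 \<or> R' 8 < n \<and> R' 9 < n \<and> R' 10 < n \<and> R' 11 < n \<and> R' 7 =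
        candidate T (R' 9) (R' 10) (R' 11) (R' 8)"
  shows "best_from (addr n a b c i) R'"
  unfolding best_from_def
proof (intro conjI assms(8) allI impI, elim conjE)
  fix a' b' c' i'
  assume less: "a' < n" "b' < n" "c' < n" "i' < n" and le: "addr n a b c i \<le> addr n a' b' c' i'"
  show "candidate T a' b' c' i' \<le> R' 7"
  proof (cases "addr n a b c i = addr n a' b' c' i'")
    case True
    then have "a = a' \<and> b = b' \<and> c = c' \<and> i = i'"
      using less assms(2-5) by (subst (asm) addr_inj) auto
    then show ?thesis using assms(7) by simp
  next
    case False
    with le have "addr n a b c (Suc i) \<le> addr n a' b' c' i'" by (simp add: addr_Suc)
    then have "candidate T a' b' c' i' \<le> R 7" using assms(1) less unfolding best_from_def by blast
    then show ?thesis using assms(6) by simp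
  qed
qed

lemma compare_correct:
  assumes "a < n" "b < n" "c < n" "i < n"
  shows "hoare (\<lambda>R M out. best_from (addr n a b c (Suc i)) R \<and> table a b c 0 M \<and>
        R 0 = a \<and> R 1 = b \<and> R 2 = c \<and> R 3 = i \<and> out = [])
      compare (time_bound compare)
      (\<lambda>R M out. best_from (addr n a b c i) R \<and> table a b c 0 M \<and>
        R 0 = a \<and> R 1 = b \<and> R 2 = c \<and> R 3 = i \<and> out = [])"
proof (rule hoare_wp, elim conjE)
  fix R M and out :: "'a list"
  assume best: "best_from (addr n a b c (Suc i)) R" and tab: "table a b c 0 M"
    and R: "R 0 = a" "R 1 = b" "R 2 = c" "R 3 = i" and out: "out = []"
  let ?g = "And (And (char_eq 3 0) (And (char_eq 3 1) (char_eq 3 2)))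
         (And (Less (Const 0) (cell (inc 3) (inc 0) (inc 1) (inc 2)))
           (Less (Reg 7) (Add (Const 4) (cell (inc 3) (inc 0) (inc 1) (inc 2)))))"
  let ?v = "opt T a b c (Suc i) (Suc a) (Suc b) (Suc c)"
  let ?Q = "\<lambda>R M out. best_from (addr n a b c i) R \<and> table a b c 0 M \<and>
        R 0 = a \<and> R 1 = b \<and> R 2 = c \<and> R 3 = i \<and> out = []"
  have bound: "?v + 4 < 2 ^ w"
    using opt_bound[of T a b c "Suc i" "Suc a" "Suc b" "Suc c"] assms(1)
        by (intro small_lt_word) simp
  have v: "M (addr (Suc n) (Suc i) (Suc a) (Suc b) (Suc c)) = ?v"
    using assms by (intro table_get[OF tab]) auto
  have val: "safe w m T (R, M, out) (Add (Const 4) (cell (inc 3) (inc 0) (inc 1) (inc 2)))"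
    "val T (R, M, out) (Add (Const 4) (cell (inc 3) (inc 0) (inc 1) (inc 2))) = 4 + ?v"
    using assms bound R by (simp_all add: v add.commute)
  have guard: "safe_cond w m T (R, M, out) ?g" "holds r T (R, M, out) ?g \<longleftrightarrow>
      (T ! i = T ! a \<and> T ! i = T ! b \<and> T ! i = T ! c) \<and> 0 < ?v \<and> R 7 < 4 + ?v"
    using assms bound R by (simp_all add: v add.commute)
  show "wp compare ?Q R M out"
  proof (cases "holds r T (R, M, out) ?g")
    case True
    then have candidate: "candidate T a b c i = 4 + ?v" "R 7 < 4 + ?v"
      unfolding guard(2) by (auto simp: candidate_def)
    have "best_from (addr n a b c i) (R(7 := 4 + ?v, 8 := i, 9 := a, 10 := b, 11 := c))"
      by (rule best_from_step[OF best assms]) (use candidate assms in auto)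
    then have "wp (Seq (Assign 7 (Add (Const 4) (cell (inc 3) (inc 0) (inc 1) (inc 2))))
        (Seq (Assign 8 (Reg 3)) (Seq (Assign 9 (Reg 0)) (Seq (Assign 10 (Reg 1)) (Assign 11 (Reg
            2)))))) ?Q R M out"
      unfolding wp.simps(2,5) val using val(1) R tab out by simp
    with guard(1) True show ?thesis unfolding compare_def by (rule wp_if_true)
  next
    case False
    \<comment> \<open>Either the letters or the cell rule out a solution and
      \<open>candidate\<close> is 0, or only the last comparison failed and register 7 is at least
      as large.\<close>
    have "candidate T a b c i \<le> R 7"
    proof (cases "T ! i = T ! a \<and> T ! i = T ! b \<and> T ! i = T ! c \<and> 0 < ?v")
      case True
      with False show ?thesis unfolding guard(2) candidate_def if_P[OF True] by linarith
    next
      case False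
      show ?thesis unfolding candidate_def if_not_P[OF False] by simp
    qed
    then have "best_from (addr n a b c i) R"
      using best by (intro best_from_step[OF best assms]) (auto simp: best_from_def)
    then have "wp Skip ?Q R M out" using R tab out by simp
    with guard(1) False show ?thesis unfolding compare_def by (rule wp_if_false)
  qed
qed

lemma search_correct:
  "hoare (\<lambda>R M out. (\<forall>x. R x = 0) \<and> out = []) search (search_time * (n + 1) ^ 7)
    (\<lambda>R M out. best_from 0 R \<and> out = [])"
proof -
  have i: "hoare (\<lambda>R M out. best_from (addr n a b (Suc c) 0) R \<and> table a b c 0 M \<and>
        R 0 = a \<and> R 1 = b \<and> R 2 = c \<and> out = [])
      (for_down 3 Len compare) ((time_bound compare + 20 + cost_exp Len) * (n + 1) ^ Suc 0)
      (\<lambda>R M out. best_from (addr n a b c 0) R \<and> table a b c 0 M \<and>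
        R 0 = a \<and> R 1 = b \<and> R 2 = c \<and> out = [])" if "a < n" "b < n" "c < n" for a b c
    unfolding addr_carry[symmetric]
    by (rule hoare_for[where N = n and x = 3 and e = Len and d = 0 and K = "time_bound compare"
        and I = "\<lambda>v R M out. best_from (addr n a b c v) R \<and> table a b c 0 M \<and>
        R 0 = a \<and> R 1 = b \<and> R 2 = c \<and> out = []", OF hoare_conseq[OF compare_correct[OF that]]])
      (auto simp: best_from_def)
  \<comment> \<open>The best solution lives in registers of \<open>kept\<close>, so it survives the
    refilling of the table.\<close>
  have fill: "hoare (\<lambda>R M out. best_from q R \<and> R 0 = a \<and> R 1 = b \<and> R 2 = c \<and> out = [])
      fill (fill_time * (n + 1) ^ 4)
      (\<lambda>R M out. best_from q R \<and> table a b c 0 M \<and> R 0 = a \<and> R 1 = b \<and> R 2 = c \<and> out = [])"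
    if "a < n" "b < n" "c < n" for a b c q
  proof (rule hoare_initial, elim conjE)
    fix R0 M0 and out0 :: "'a list"
    assume "best_from q R0" and R0: "R0 0 = a" "R0 1 = b" "R0 2 = c" "out0 = []"
    have "best_from q R" if "kept R = a # b # c # map R0 [7, 8, 9, 10, 11, 13]" for R
      using \<open>best_from q R0\<close> that by (subst best_from_cong[of R R0]) auto
    then show "hoare (\<lambda>R M out. R = R0 \<and> M = M0 \<and> out = out0) fill (fill_time * (n + 1) ^ 4)
      (\<lambda>R M out. best_from q R \<and> table a b c 0 M \<and> R 0 = a \<and> R 1 = b \<and> R 2 = c \<and> out = [])"
      using that R0
      by (intro hoare_conseq[OF fill_correct[of a b c "map R0 [7, 8, 9, 10, 11, 13]" "[]"]]) auto
  qed
  have body: "hoare (\<lambda>R M out. best_from (addr n a b (Suc c) 0) R \<and> R 0 = a \<and> R 1 = b \<and> R 2 = c \<and>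
      out = [])
      (Seq fill (for_down 3 Len compare)) ((fill_time + time_bound compare + 20 + cost_exp Len) *
          (n + 1) ^ 4)
      (\<lambda>R M out. best_from (addr n a b c 0) R \<and> R 0 = a \<and> R 1 = b \<and> R 2 = c \<and> out = [])"
    if "a < n" "b < n" "c < n" for a b c
  proof -
    \<comment> \<open>The linear cost of the loop over \<open>i\<close> is absorbed by that of
      \<open>fill\<close>; the search over \<open>i\<close> adds no factor.\<close>
    have "(n + 1) ^ Suc 0 \<le> (n + 1) ^ 4" by (rule power_increasing) auto
    then have "(time_bound compare + 20 + cost_exp Len) * (n + 1) ^ Suc 0 \<le>
        (time_bound compare + 20 + cost_exp Len) * (n + 1) ^ 4" by (rule mult_left_mono) simp
    then have "fill_time * (n + 1) ^ 4 + (time_bound compare + 20 + cost_exp Len) * (n + 1) ^ Suc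
        0 \<le>
        (fill_time + time_bound compare + 20 + cost_exp Len) * (n + 1) ^ 4"
      by (simp only: add_mult_distrib)
    then show ?thesis
      by (intro hoare_conseq[OF hoare_seq[OF fill[OF that] i[OF that]]]) auto
  qed
  have c: "hoare (\<lambda>R M out. best_from (addr n a (Suc b) 0 0) R \<and> R 0 = a \<and> R 1 = b \<and> out = [])
      (for_down 2 Len (Seq fill (for_down 3 Len compare)))
      ((fill_time + time_bound compare + 20 + cost_exp Len + 20 + cost_exp Len) * (n + 1) ^ Suc 4)
      (\<lambda>R M out. best_from (addr n a b 0 0) R \<and> R 0 = a \<and> R 1 = b \<and> out = [])"
    if "a < n" "b < n" for a b
    unfolding addr_carry[symmetric]
    by (rule hoare_for[where N = n and x = 2 and e = Len and d = 4
        and I = "\<lambda>v R M out. best_from (addr n a b v 0) R \<and> R 0 = a \<and> R 1 = b \<and> out = []",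
        OF hoare_conseq[OF body[OF that]]]) (auto simp: best_from_def)
  have b: "hoare (\<lambda>R M out. best_from (addr n (Suc a) 0 0 0) R \<and> R 0 = a \<and> out = [])
      (for_down 1 Len (for_down 2 Len (Seq fill (for_down 3 Len compare))))
      ((fill_time + time_bound compare + 20 + cost_exp Len + 20 + cost_exp Len + 20 + cost_exp
          Len) * (n + 1) ^ Suc (Suc 4))
      (\<lambda>R M out. best_from (addr n a 0 0 0) R \<and> R 0 = a \<and> out = [])"
    if "a < n" for a
    unfolding addr_carry[symmetric]
    by (rule hoare_for[where N = n and x = 1 and e = Len and d = "Suc 4"
        and I = "\<lambda>v R M out. best_from (addr n a v 0 0) R \<and> R 0 = a \<and> out = []",
        OF hoare_conseq[OF c[OF that]]]) (auto simp: best_from_def)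
  have a: "hoare (\<lambda>R M out. best_from (addr n n 0 0 0) R \<and> out = []) search
      ((fill_time + time_bound compare + 20 + cost_exp Len + 20 + cost_exp Len + 20 + cost_exp Len
          + 20 + cost_exp Len) * (n + 1) ^ Suc (Suc (Suc 4)))
      (\<lambda>R M out. best_from (addr n 0 0 0 0) R \<and> out = [])"
    unfolding search_def
    by (rule hoare_for[where N = n and x = 0 and e = Len and d = "Suc (Suc 4)"
        and I = "\<lambda>v R M out. best_from (addr n v 0 0 0) R \<and> out = []",
        OF hoare_conseq[OF b]]) (auto simp: best_from_def)
  \<comment> \<open>No quadruple has an address of \<open>n ^ 4\<close> or more, and register 7
    being 0 stands for "nothing found yet".\<close>
  have init: "best_from (addr n n 0 0 0) R" if "\<forall>x. R x = 0" for R
  proof -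
    have "\<not> addr n n 0 0 0 \<le> addr n a b c i" if "a < n" "b < n" "c < n" "i < n" for a b c i
      using addr_less[of a n b c i] that by (simp add: addr_def power4_eq_xxxx algebra_simps)
    then show ?thesis using that unfolding best_from_def by auto
  qed
  show ?thesis
    by (rule hoare_conseq[OF a]) (auto simp: init addr_zero search_time_def numeral_eq_Suc)
qed

end

section \<open>Writing the result by traceback\<close>

definition trace_guard :: cond where
  "trace_guard = Less (Const 0) (cell (Reg 3) (Reg 4) (Reg 5) (Reg 6))"

text \<open>Each turn advances an index, so there are at most \<open>4 * n\<close> turns; the factor
  5 also absorbs the final test.\<close>

definition trace_time :: nat where
  "trace_time = time_bound trace_start + 5 * (1 + cost_cond trace_guard + time_bound trace_step)"

definition main_time :: nat where
  "main_time = search_time + fill_time + 4 * trace_time + 100"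

definition rest :: "nat \<Rightarrow> 'a list \<times> 'a list \<Rightarrow> 'a list" where
  "rest p VW = (if p = 0 then fst VW else fst VW @ snd VW)"

context ram
begin

text \<open>The text written so far, followed by what \<open>opt_pair\<close> still promises from
  the current cell, is always the same string \<open>goal\<close>.\<close>

definition trace_inv :: "nat \<Rightarrow> nat \<Rightarrow> nat \<Rightarrow> nat \<Rightarrow> nat \<Rightarrow> 'a list \<Rightarrow> 'a assn" where
  "trace_inv a b c s p goal R M out \<longleftrightarrow> table a b c 0 M \<and> R 0 = a \<and> R 1 = b \<and> R 2 = c \<and> R 8 = s \<and>
      R 13 = p \<and>
     R 3 \<le> n \<and> R 4 \<le> n \<and> R 5 \<le> n \<and> R 6 \<le> n \<and>
     out @ rest p (opt_pair T a b c (R 3) (R 4) (R 5) (R 6)) = goal"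

lemma trace_guard_correct:
  assumes "trace_inv a b c s p goal R M out"
  shows "safe_cond w m T (R, M, out) trace_guard"
    and "holds r T (R, M, out) trace_guard \<longleftrightarrow> 0 < opt T a b c (R 3) (R 4) (R 5) (R 6)"
proof -
  have "M (addr (Suc n) (R 3) (R 4) (R 5) (R 6)) = opt T a b c (R 3) (R 4) (R 5) (R 6)"
    using assms unfolding trace_inv_def by (intro table_get) auto
  then show "safe_cond w m T (R, M, out) trace_guard"
    and "holds r T (R, M, out) trace_guard \<longleftrightarrow> 0 < opt T a b c (R 3) (R 4) (R 5) (R 6)"
    using assms by (simp_all add: trace_inv_def trace_guard_def)
qed

text \<open>Each branch of \<open>trace_step\<close> mirrors one unfolding of
  \<open>opt_pair\<close>, so the invariant is preserved; \<open>f\<close> is the total distance of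
  the four indices to their ends.\<close>

lemma trace_step_correct:
  assumes abc: "a \<le> n" "b \<le> n" "c \<le> n"
  defines "f \<equiv> \<lambda>R :: nat \<Rightarrow> nat. (a - R 3) + (b - R 4) + (c - R 5) + (n - R 6)"
  shows "hoare (\<lambda>R M out. trace_inv a b c s p goal R M out \<and> holds r T (R, M, out) trace_guard \<and>
      f R = z)
      trace_step (time_bound trace_step)
      (\<lambda>R M out. trace_inv a b c s p goal R M out \<and> f R < z)"
proof (rule hoare_wp, elim conjE)
  fix R M out
  assume inv: "trace_inv a b c s p goal R M out" and guard: "holds r T (R, M, out) trace_guard"
      and z: "f R = z"
  define i j k l where "i = R 3" and "j = R 4" and "k = R 5" and "l = R 6"
  note idx = i_def[symmetric] j_def[symmetric] k_def[symmetric] l_def[symmetric]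
  have tab: "table a b c 0 M" and R: "R 0 = a" "R 1 = b" "R 2 = c" "R 8 = s" "R 13 = p"
    and out: "out @ rest p (opt_pair T a b c i j k l) = goal" and le: "i \<le> n" "j \<le> n" "k \<le> n" "l \<le>
        n"
    using inv by (auto simp: trace_inv_def idx)
  have pos: "opt T a b c i j k l \<noteq> 0"
    using trace_guard_correct(2)[OF inv] guard by (simp add: idx)
  then have range: "i < a" "j < b" "k < c" using opt_pos_range[of T a b c i j k l] by auto
  then have less: "i < n" "j < n" "k < n" using abc by auto
  have get: "M (addr (Suc n) i' j' k' l') = opt T a b c i' j' k' l'"
    if "i' \<le> n" "j' \<le> n" "k' \<le> n" "l' \<le> n" for i' j' k' l'
    using that by (intro table_get[OF tab]) auto
  let ?Q = "\<lambda>R M out. trace_inv a b c s p goal R M out \<and> f R < z"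
  let ?v = "cell (Reg 3) (Reg 4) (Reg 5) (Reg 6)"
  have inc: "safe w m T (R, M, out) (inc 3)" "val T (R, M, out) (inc 3) = Suc i"
    "safe w m T (R, M, out) (inc 4)" "val T (R, M, out) (inc 4) = Suc j"
    "safe w m T (R, M, out) (inc 5)" "val T (R, M, out) (inc 5) = Suc k"
    using le by (simp_all add: idx)
  have eqs: "safe_cond w m T (R, M, out) (Eq (cell (inc 3) (Reg 4) (Reg 5) (Reg 6)) ?v)"
    "holds r T (R, M, out) (Eq (cell (inc 3) (Reg 4) (Reg 5) (Reg 6)) ?v) \<longleftrightarrow>
      opt T a b c (Suc i) j k l = opt T a b c i j k l"
    "safe_cond w m T (R, M, out) (Eq (cell (Reg 3) (inc 4) (Reg 5) (Reg 6)) ?v)"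
    "holds r T (R, M, out) (Eq (cell (Reg 3) (inc 4) (Reg 5) (Reg 6)) ?v) \<longleftrightarrow>
      opt T a b c i (Suc j) k l = opt T a b c i j k l"
    "safe_cond w m T (R, M, out) (Eq (cell (Reg 3) (Reg 4) (inc 5) (Reg 6)) ?v)"
    "holds r T (R, M, out) (Eq (cell (Reg 3) (Reg 4) (inc 5) (Reg 6)) ?v) \<longleftrightarrow>
      opt T a b c i j (Suc k) l = opt T a b c i j k l"
    "safe_cond w m T (R, M, out) (Less (Reg 6) Len)"
    "holds r T (R, M, out) (Less (Reg 6) Len) \<longleftrightarrow> l < n"
    using le less by (simp_all add: idx get)
  show "wp trace_step ?Q R M out"
  proof (cases "opt T a b c (Suc i) j k l = opt T a b c i j k l")
    case True
    have "opt_pair T a b c i j k l = opt_pair T a b c (Suc i) j k l"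
      by (subst opt_pair.simps) (simp only: if_not_P[OF pos] if_P[OF True])
    then have "?Q (R(3 := Suc i)) M out"
      using z tab R out le less range by (simp add: trace_inv_def f_def idx; arith)
    then have "wp (Assign 3 (inc 3)) ?Q R M out" by (simp only: wp.simps(2) inc simp_thms)
    then show ?thesis unfolding trace_step_def Let_def
      by (intro wp_if_true[OF eqs(1) eqs(2)[THEN iffD2, OF True]])
  next
    case i: False
    note i_if = wp_if_false[OF eqs(1) i[folded eqs(2)]]
    show ?thesis
    proof (cases "opt T a b c i (Suc j) k l = opt T a b c i j k l")
      case True
      have "opt_pair T a b c i j k l = opt_pair T a b c i (Suc j) k l"
        by (subst opt_pair.simps) (simp only: if_not_P[OF pos] if_not_P[OF i] if_P[OF True])
      then have "?Q (R(4 := Suc j)) M out"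
        using z tab R out le less range by (simp add: trace_inv_def f_def idx; arith)
      then have "wp (Assign 4 (inc 4)) ?Q R M out" by (simp only: wp.simps(2) inc simp_thms)
      then show ?thesis unfolding trace_step_def Let_def
        by (intro i_if wp_if_true[OF eqs(3) eqs(4)[THEN iffD2, OF True]])
    next
      case j: False
      note j_if = wp_if_false[OF eqs(3) j[folded eqs(4)]]
      show ?thesis
      proof (cases "opt T a b c i j (Suc k) l = opt T a b c i j k l")
        case True
        have "opt_pair T a b c i j k l = opt_pair T a b c i j (Suc k) l"
          by (subst opt_pair.simps) (simp only: if_not_P[OF pos] if_not_P[OF i] if_not_P[OF j]
              if_P[OF True])
        then have "?Q (R(5 := Suc k)) M out"
          using z tab R out le less range by (simp add: trace_inv_def f_def idx; arith)
        then have "wp (Assign 5 (inc 5)) ?Q R M out" by (simp only: wp.simps(2) inc simp_thms)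
        then show ?thesis unfolding trace_step_def Let_def
          by (intro i_if j_if wp_if_true[OF eqs(5) eqs(6)[THEN iffD2, OF True]])
      next
        case k: False
        note k_if = wp_if_false[OF eqs(5) k[folded eqs(6)]]
        show ?thesis
        proof (cases "l < n")
          case l: True
          note l_if = wp_if_true[OF eqs(7) eqs(8)[THEN iffD2, OF l]]
          have eq: "safe_cond w m T (R, M, out) (Eq (cell (Reg 3) (Reg 4) (Reg 5) (inc 6)) ?v)"
            "holds r T (R, M, out) (Eq (cell (Reg 3) (Reg 4) (Reg 5) (inc 6)) ?v) \<longleftrightarrow>
              opt T a b c i j k (Suc l) = opt T a b c i j k l"
            using le l by (simp_all add: idx get)
          show ?thesis
          proof (cases "opt T a b c i j k (Suc l) = opt T a b c i j k l")
            case True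
            have "opt_pair T a b c i j k l = opt_pair T a b c i j k (Suc l)"
              by (subst opt_pair.simps) (simp only: if_not_P[OF pos] if_not_P[OF i]
                if_not_P[OF j] if_not_P[OF k] if_P[OF l] if_P[OF True])
            then have "?Q (R(6 := Suc l)) M out"
              using z tab R out le l range by (simp add: trace_inv_def f_def idx; arith)
            then have "wp (Assign 6 (inc 6)) ?Q R M out" using le by (simp add: idx)
            then show ?thesis unfolding trace_step_def Let_def
              by (intro i_if j_if k_if l_if wp_if_true[OF eq(1) eq(2)[THEN iffD2, OF True]])
          next
            case False
            have "opt_pair T a b c i j k l = apfst ((#) (T ! i)) (opt_pair T a b c (Suc i) (Suc j)
                (Suc k) (Suc l))"
              by (subst opt_pair.simps) (simp only: if_not_P[OF pos] if_not_P[OF i]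
                if_not_P[OF j] if_not_P[OF k] if_P[OF l] if_not_P[OF False])
            then have "?Q (R(3 := Suc i, 4 := Suc j, 5 := Suc k, 6 := Suc l)) M (out @ [T ! i])"
              using z tab R out le l less range
                  by (simp add: trace_inv_def f_def idx rest_def split: if_splits; arith)
            then have "wp (Seq (Emit (Reg 3)) (Seq (Seq (Assign 3 (inc 3)) (Seq (Assign 4 (inc 4))
                (Assign 5 (inc 5)))) (Assign 6 (inc 6)))) ?Q R M out"
              using le less by (simp add: idx)
            then show ?thesis unfolding trace_step_def Let_def
              by (intro i_if j_if k_if l_if wp_if_false[OF eq(1) False[folded eq(2)]])
          qed
        next
          case l: False
          note l_if = wp_if_false[OF eqs(7) l[folded eqs(8)]]
          have "opt_pair T a b c i j k l = apsnd ((#) (T ! i)) (opt_pair T a b c (Suc i) (Suc j)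
              (Suc k) l)"
            by (subst opt_pair.simps) (simp only: if_not_P[OF pos] if_not_P[OF i]
                if_not_P[OF j] if_not_P[OF k] if_not_P[OF l])
          \<comment> \<open>With an empty \<open>V\<close> part, the letter added to
            \<open>W\<close> is the next one of \<open>V @ W\<close>. If \<open>p = 0\<close>,
            nothing is left to write and the loop only runs out.\<close>
          moreover have "fst (opt_pair T a b c (Suc i) (Suc j) (Suc k) l) = []"
          proof (cases "0 < opt T a b c (Suc i) (Suc j) (Suc k) l")
            case True
            then show ?thesis using opt_pair_sound[OF True abc] l
                by (auto simp: embeds_def segment_empty)
          next
            case False
            then show ?thesis by (subst opt_pair.simps) simp
          qed
          ultimately have "?Q (R(3 := Suc i, 4 := Suc j, 5 :=
              Suc k)) M (out @ (if 0 < p then [T ! i] else []))"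
            using z tab R out le less range
                by (simp add: trace_inv_def f_def idx rest_def split: if_splits; arith)
          then have "wp (Seq (If (Less (Const 0) (Reg 13)) (Emit (Reg 3)) Skip)
              (Seq (Assign 3 (inc 3)) (Seq (Assign 4 (inc 4)) (Assign 5 (inc 5))))) ?Q R M out"
            using le less R by (cases "p = 0") (simp_all add: idx)
          then show ?thesis unfolding trace_step_def Let_def
            by (intro i_if j_if k_if l_if)
        qed
      qed
    qed
  qed
qed

lemma trace_correct:
  assumes less: "a < n" "b < n" "c < n" "s < n"
  shows "hoare (\<lambda>R M out. table a b c 0 M \<and> R 0 = a \<and> R 1 = b \<and> R 2 = c \<and> R 8 = s \<and> R 13 = p \<and>
      out = o')
      trace (trace_time * (n + 1))
      (\<lambda>R M out. table a b c 0 M \<and> R 0 = a \<and> R 1 = b \<and> R 2 = c \<and> R 8 = s \<and> R 13 = p \<and>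
        out = o' @ T ! s # rest p (opt_pair T a b c (Suc s) (Suc a) (Suc b) (Suc c)))"
proof -
  let ?f = "\<lambda>R :: nat \<Rightarrow> nat. (a - R 3) + (b - R 4) + (c - R 5) + (n - R 6)"
  let ?goal = "o' @ T ! s # rest p (opt_pair T a b c (Suc s) (Suc a) (Suc b) (Suc c))"
  have start: "hoare (\<lambda>R M out. table a b c 0 M \<and> R 0 = a \<and> R 1 = b \<and> R 2 = c \<and> R 8 = s \<and> R 13 =
      p \<and> out = o')
      trace_start (time_bound trace_start) (\<lambda>R M out. trace_inv a b c s p ?goal R M out \<and> ?f R \<le>
          4 * n)"
    by (rule hoare_wp) (use less in \<open>simp add: trace_start_def trace_inv_def Suc_le_eq\<close>)
  have "a \<le> n" "b \<le> n" "c \<le> n" using less by auto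
  note step = trace_step_correct[OF this, of s p ?goal]
  have loop: "hoare (\<lambda>R M out. trace_inv a b c s p ?goal R M out \<and> ?f R \<le>
      4 * n) (While trace_guard trace_step)
      (4 * n * (1 + cost_cond trace_guard + time_bound trace_step) + (1 + cost_cond trace_guard))
      (\<lambda>R M out. trace_inv a b c s p ?goal R M out \<and> \<not> holds r T (R, M, out) trace_guard)"
    by (rule hoare_while[OF trace_guard_correct(1) step])
  have time: "time_bound trace_start + (4 * n * (1 + cost_cond trace_guard + time_bound
      trace_step) + (1 + cost_cond trace_guard))
      \<le> trace_time * (n + 1)"
    unfolding trace_time_def by (simp add: algebra_simps)
  show ?thesis
    unfolding trace_def trace_guard_def[symmetric]
  proof (rule hoare_conseq[OF hoare_seq[OF start loop] _ _ time], assumption)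
    fix R M out
    assume inv: "trace_inv a b c s p ?goal R M out \<and> \<not> holds r T (R, M, out) trace_guard"
    \<comment> \<open>At exit the value is 0, so \<open>opt_pair\<close> promises nothing more and
      the output is the whole goal.\<close>
    then have "opt T a b c (R 3) (R 4) (R 5) (R 6) = 0" using trace_guard_correct(2) by blast
    then have "opt_pair T a b c (R 3) (R 4) (R 5) (R 6) = ([], [])" by (subst opt_pair.simps) simp
    then show "table a b c 0 M \<and> R 0 = a \<and> R 1 = b \<and> R 2 = c \<and> R 8 = s \<and> R 13 = p \<and> out = ?goal"
      using inv by (auto simp: trace_inv_def rest_def)
  qed
qed

section \<open>Correctness and cost of the whole program\<close>

lemma main_correct:
  "hoare (\<lambda>R M out. (\<forall>x. R x = 0) \<and> out = []) main (main_time * (n + 1) ^ 7)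
    (\<lambda>R M S. if \<exists>S'. longest_subseq_with_exponent_in exponent_set T S'
       then longest_subseq_with_exponent_in exponent_set T S else S = [])"
  (is "hoare _ _ _ ?post")
proof -
  let ?assigns = "Seq (Assign 0 (Reg 9)) (Seq (Assign 1 (Reg 10)) (Assign 2 (Reg 11)))"
  let ?out = "Seq ?assigns (Seq fill (Seq (Assign 13 (Const 1))
      (Seq trace (Seq trace (Seq trace (Seq (Assign 13 (Const 0)) trace))))))"
  let ?t = "time_bound ?assigns + (fill_time * (n + 1) ^ 4 + (time_bound (Assign 13 (Const 1)) +
      (trace_time * (n + 1) + (trace_time * (n + 1) + (trace_time * (n + 1) +
        (time_bound (Assign 13 (Const 0)) + trace_time * (n + 1)))))))"
  have out: "hoare (\<lambda>R M out. R = R0 \<and> M = M0 \<and> out = []) ?out ?t ?post"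
    if best: "best_from 0 R0" and pos: "0 < R0 7" for R0 M0
  proof -
    define a b c s where "a = R0 9" and "b = R0 10" and "c = R0 11" and "s = R0 8"
    note defs = a_def b_def c_def s_def
    have less: "a < n" "b < n" "c < n" "s < n" and candidate: "R0 7 = candidate T a b c s"
      using best pos unfolding best_from_def defs by auto
    have "longest_subseq_with_exponent_in exponent_set T (result T a b c s)"
      using less pos candidate best unfolding best_from_def by (intro longest_result) auto
    then have post: "?post R M (result T a b c s)" for R M by auto
    let ?V = "[R0 7, R0 8, R0 9, R0 10, R0 11, R0 13]"
    let ?U = "T ! s # rest 1 (opt_pair T a b c (Suc s) (Suc a) (Suc b) (Suc c))"
    let ?P = "\<lambda>p o' R M out. table a b c 0 M \<and> R 0 = a \<and> R 1 = b \<and> R 2 = c \<and> R 8 = s \<and> R 13 = p \<and>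
        out = o'"
    have 1: "hoare (\<lambda>R M out. R = R0 \<and> M = M0 \<and> out = []) ?assigns (time_bound ?assigns)
        (\<lambda>R M out. kept R = a # b # c # ?V \<and> out = [])"
      by (rule hoare_wp) (simp add: defs)
    have 2: "hoare (\<lambda>R M out. kept R = a # b # c # ?V \<and> out = []) fill (fill_time * (n + 1) ^ 4)
        (\<lambda>R M out. table a b c 0 M \<and> kept R = a # b # c # ?V \<and> out = [])"
      using less by (intro fill_correct) auto
    have 3: "hoare (\<lambda>R M out. table a b c 0 M \<and> kept R = a # b # c # ?V \<and> out = [])
        (Assign 13 (Const 1)) (time_bound (Assign 13 (Const 1))) (?P 1 [])"
      by (rule hoare_wp) (simp add: defs)
    have 4: "hoare (?P 1 (?U @ ?U @ ?U)) (Assign 13 (Const 0)) (time_bound (Assign 13 (Const 0)))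
        (?P 0 (?U @ ?U @ ?U))"
      by (rule hoare_wp) simp
    note trace = trace_correct[OF less]
    have fin: "?P 0 ((?U @ ?U @ ?U) @ T ! s # rest 0 (opt_pair T a b c (Suc s) (Suc a) (Suc b)
        (Suc c))) R M out \<Longrightarrow>
        ?post R M out" for R M out
    proof (elim conjE)
      assume "out = (?U @ ?U @ ?U) @ T ! s # rest 0 (opt_pair T a b c (Suc s) (Suc a) (Suc b) (Suc
          c))"
      then have "out = result T a b c s" by (simp add: result_def rest_def case_prod_unfold Let_def)
      with post show "?post R M out" by (simp only:)
    qed
    have 5: "hoare (?P 0 (?U @ ?U @ ?U)) trace (trace_time * (n + 1)) ?post"
      by (rule hoare_conseq[OF trace _ fin le_refl])
    have tr1: "hoare (?P 1 []) trace (trace_time * (n + 1)) (?P 1 ?U)"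
      and tr2: "hoare (?P 1 ?U) trace (trace_time * (n + 1)) (?P 1 (?U @ ?U))"
      and tr3: "hoare (?P 1 (?U @ ?U)) trace (trace_time * (n + 1)) (?P 1 (?U @ ?U @ ?U))"
      using trace[of 1 "[]"] trace[of 1 ?U] trace[of 1 "?U @ ?U"] by simp_all
    show ?thesis
      by (intro hoare_seq[OF 1] hoare_seq[OF 2] hoare_seq[OF 3] hoare_seq[OF tr1] hoare_seq[OF tr2]
          hoare_seq[OF tr3] hoare_seq[OF 4] 5)
  qed
  have "hoare (\<lambda>R M out. best_from 0 R \<and> out = []) (If (Less (Const 0) (Reg 7)) ?out Skip)
      (1 + cost_cond (Less (Const 0) (Reg 7)) + ?t + 1) ?post"
  proof (rule hoare_if)
    show "hoare (\<lambda>R M out. (best_from 0 R \<and> out = []) \<and> holds r T (R, M, out) (Less (Const 0) (Reg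
        7))) ?out ?t ?post"
    proof (rule hoare_initial, elim conjE)
      fix R0 M0 and out0 :: "'a list"
      assume "best_from 0 R0" "out0 = []" "holds r T (R0, M0, out0) (Less (Const 0) (Reg 7))"
      then show "hoare (\<lambda>R M out. R = R0 \<and> M = M0 \<and> out = out0) ?out ?t ?post"
        using out[of R0 M0] by simp
    qed
    \<comment> \<open>Register 7 being 0 after all quadruples have been visited means that every
      \<open>candidate\<close> is 0.\<close>
    have none: "\<not> longest_subseq_with_exponent_in exponent_set T S" if "best_from 0 R" "R 7 = 0"
        for R S
      using no_longest[of T] that unfolding best_from_def by auto
    have "hoare (\<lambda>R M out. (best_from 0 R \<and> out = []) \<and> \<not> holds r T (R, M, out) (Less (Const 0)
        (Reg 7)))
        Skip (time_bound Skip) ?post"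
      by (rule hoare_wp) (auto dest: none)
    then show "hoare (\<lambda>R M out. (best_from 0 R \<and> out = []) \<and> \<not> holds r T (R, M, out) (Less (Const
        0) (Reg 7)))
        Skip 1 ?post" by simp
  qed simp
  note final = hoare_seq[OF search_correct this]
  have "fill_time * (n + 1) ^ 4 \<le> fill_time * (n + 1) ^ 7"
    "trace_time * (n + 1) \<le> trace_time * (n + 1) ^ 7" "100 * 1 \<le> 100 * (n + 1) ^ 7"
    by (intro mult_left_mono power_increasing self_le_power one_le_power; simp)+
  note bounds = this
  \<comment> \<open>The 15 collects the constant costs: 6 for copying the starts, 4 for the two
    assignments to register 13, and 5 for the conditional with both branches counted.\<close>
  have "search_time * (n + 1) ^ 7 + (1 + cost_cond (Less (Const 0) (Reg 7)) + ?t + 1) =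
      search_time * (n + 1) ^ 7 + (fill_time * (n + 1) ^ 4 + 4 * (trace_time * (n + 1)) + 15)"
    by simp
  also have "\<dots> \<le> search_time * (n + 1) ^ 7 + (fill_time * (n + 1) ^ 7 + 4 * (trace_time * (n + 1)
      ^ 7) + 100 * (n + 1) ^ 7)"
    using bounds by linarith
  also have "\<dots> = main_time * (n + 1) ^ 7"
    unfolding main_time_def add_mult_distrib by simp
  finally have time: "search_time * (n + 1) ^ 7 + (1 + cost_cond (Less (Const 0) (Reg 7)) + ?t +
      1) \<le> main_time * (n + 1) ^ 7" .
  show ?thesis unfolding main_def by (rule hoare_conseq[OF final _ _ time])
qed

end

section \<open>Word length and asymptotics\<close>

lemma power_ceiling_log: "x \<le> 2 ^ nat \<lceil>log 2 (real x)\<rceil>" if "1 \<le> x"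
proof -
  have "real x = 2 powr log 2 (real x)" using that by simp
  also have "\<dots> \<le> 2 powr real (nat \<lceil>log 2 (real x)\<rceil>)"
    by (intro powr_mono) (auto intro: real_nat_ceiling_ge)
  also have "\<dots> = real (2 ^ nat \<lceil>log 2 (real x)\<rceil>)" by (simp add: powr_realpow)
  finally show ?thesis by (simp only: of_nat_le_iff)
qed

text \<open>From 1 on, \<open>k + 1\<close> is at most \<open>2 * k\<close>, which costs the factor
  \<open>2 ^ d\<close>, and the constant \<open>D\<close> is absorbed by
  \<open>k ^ d\<close>.\<close>

lemma Suc_power_bigo: "(\<lambda>k. real (C * (k + 1) ^ d + D)) \<in> O(\<lambda>k. real k ^ d)"
proof (rule bigoI)
  show "\<forall>\<^sub>F k in sequentially. norm (real (C * (k + 1) ^ d + D)) \<le>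
      real (C * 2 ^ d + D) * norm (real k ^ d)"
    using eventually_ge_at_top[of 1]
  proof eventually_elim
    case (elim k)
    have "(k + 1) ^ d \<le> (2 * k) ^ d" using elim by (intro power_mono) auto
    then have "C * (k + 1) ^ d \<le> C * 2 ^ d * k ^ d" by (simp add: power_mult_distrib)
    moreover have "D * 1 \<le> D * k ^ d" using elim by (intro mult_left_mono one_le_power) auto
    ultimately have "C * (k + 1) ^ d + D \<le> (C * 2 ^ d + D) * k ^ d"
      unfolding add_mult_distrib by linarith
    then have "real (C * (k + 1) ^ d + D) \<le> real ((C * 2 ^ d + D) * k ^ d)" by (rule of_nat_mono)
    then show ?case by (simp only: norm_of_nat of_nat_mult of_nat_power norm_power)
  qed
qed

theorem theorem3:
  "\<exists>time space :: nat \<Rightarrow> nat.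
     (\<lambda>n. real (time n)) \<in> O(\<lambda>n. real n ^ 7) \<and>
     (\<lambda>n. real (space n)) \<in> O(\<lambda>n. real n ^ 4) \<and>
     computable_in
       (\<lambda>(T :: 'a list) S.
          if \<exists>S'. longest_subseq_with_exponent_in exponent_set T S'
          then longest_subseq_with_exponent_in exponent_set T S
          else S = [])
       time space"
proof (intro exI conjI)
  let ?time = "\<lambda>k. main_time * (k + 1) ^ 7 + 0"
      and ?space = "\<lambda>k. 1 * (k + 1) ^ 4 + card (regs main)"
  show "(\<lambda>k. real (?time k)) \<in> O(\<lambda>n. real n ^ 7)" by (rule Suc_power_bigo)
  show "(\<lambda>k. real (?space k)) \<in> O(\<lambda>n. real n ^ 4)" by (rule Suc_power_bigo)
  show "computable_in
       (\<lambda>(T :: 'a list) S.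
          if \<exists>S'. longest_subseq_with_exponent_in exponent_set T S'
          then longest_subseq_with_exponent_in exponent_set T S
          else S = [])
       ?time ?space"
    unfolding computable_in_def
  \<comment> \<open>Words of 8 times the rounded logarithm of \<open>n + 2\<close> make
    \<open>2 ^ w\<close> at least \<open>(n + 2) ^ 8\<close>, the assumption \<open>word\<close> of
    \<open>ram\<close>.\<close>
  proof (rule exI[of _ main], rule exI[of _ 8], intro allI impI, elim conjE)
    fix \<Sigma> :: "'a set" and r and T :: "'a list"
    assume lin: "linear_order_on \<Sigma> r" and T: "set T \<subseteq> \<Sigma>"
    let ?L = "nat \<lceil>log 2 (real (length T + 2))\<rceil>" and ?m = "(length T + 1) ^ 4"
    have "(length T + 2) ^ 8 \<le> (2 ^ ?L) ^ 8"
      using power_ceiling_log[of "length T + 2"] by (intro power_mono) auto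
    also have "(2 ^ ?L) ^ 8 = (2::nat) ^ (8 * ?L)"
      by (subst mult.commute) (rule power_mult[symmetric])
    finally have word: "(length T + 2) ^ 8 \<le> 2 ^ (8 * ?L)" .
    interpret ram r "8 * ?L" ?m T \<Sigma>
      by (rule ram.intro[OF lin T refl word])
    obtain t R M S where
      "t \<le> main_time * (length T + 1) ^ 7" "run r (8 * ?L) ?m T main init_state t (R, M, S)"
      "if \<exists>S'. longest_subseq_with_exponent_in exponent_set T S'
          then longest_subseq_with_exponent_in exponent_set T S else S = []"
      using main_correct[unfolded hoare_def, rule_format, of "\<lambda>_. 0" "[]" "\<lambda>_. 0"]
      unfolding init_state_def by auto
    then show "\<exists>m t R M S. run r (8 * ?L) m T main init_state t (R, M, S) \<and> t \<le> ?time (length T) \<and>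
        card (regs main) + m \<le> ?space (length T) \<and>
        (if \<exists>S'. longest_subseq_with_exponent_in exponent_set T S'
          then longest_subseq_with_exponent_in exponent_set T S else S = [])"
      by (intro exI[of _ ?m] exI[of _ t] exI[of _ R] exI[of _ M] exI[of _ S]) simp
  qed
qed

end
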